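(* Let $L>0$ and let $g(x)=\frac12(L^2-x^2)$ for $x\in[0,L]$. Consider the closed-loop system consisting of the PDE-ODE cascade $$\dot{\vartheta}(t)=\int_0^L u(y,t)\,dy,\qquad \partial_t u(x,t)=\partial_{xx}u(x,t),\qquad \partial_x u(0,t)=0,\qquad u(L,t)=U(t),$$ for $x\in[0,L]$, $t\ge0$, with $\vartheta(t)\in\mathbb{R}$ and $u(\cdot,t)$ real-valued on $[0,L]$, together with the controller $$U(t)=\bar{K}Z(t),\qquad Z(t)=\vartheta(t)+\int_0^L g(y)u(y,t)\,dy.$$ If $\bar K\in\mathbb{R}$ is such that $$\bar K<0\quad\text{and}\quad \bar K\neq-\frac{(2\kappa+1)^2\pi^2}{4L^3}\ \text{ for all }\kappa\in\{0,1,2,\dots\},$$ then, for any initial condition $\vartheta(0)\in\mathbb{R}$, $u(\cdot,0)\in L^2(0,L)$, the closed-loop system has a unique solution $(\vartheta(t),u(\cdot,t))\in C([0,\infty),\mathbb{R}\times L^2(0,L))$, and it is exponentially stable: there exist positive constants $\eta$ and $\nu$, independent of the initial condition, such that for all $t\ge0$ $$\Omega(t)\le\eta\,\Omega(0)e^{-\nu t},\qquad\text{where}\quad \Omega(t)=|\vartheta(t)|^2+\int_0^L u^2(x,t)\,dx.$$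
   Context: Solutions of the closed-loop PDE-ODE system are understood in the weak sense. *)

theory Defs
  imports "HOL-Analysis.Analysis"
begin

text \<open>
  Elements of \<open>L\<^sup>2(0,L)\<close> are represented by functions on the reals; the values outside
  \<open>[0,L]\<close> and on null sets are irrelevant, so equality in \<open>L\<^sup>2(0,L)\<close> is equality almost
  everywhere with respect to \<^term>\<open>lebesgue_on {0..L}\<close>.
\<close>

definition L2_on :: "real \<Rightarrow> (real \<Rightarrow> real) \<Rightarrow> bool" where
  "L2_on L f \<longleftrightarrow> f \<in> borel_measurable (lebesgue_on {0..L}) \<and>
     integrable (lebesgue_on {0..L}) (\<lambda>x. (f x)\<^sup>2)"

text \<open>A state trajectory is \<open>t \<mapsto> (\<theta> t, u t)\<close>, with \<open>u t x\<close> standing for \<open>u(x,t)\<close>.\<close>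

definition continuous_state ::
  "real \<Rightarrow> (real \<Rightarrow> real) \<Rightarrow> (real \<Rightarrow> real \<Rightarrow> real) \<Rightarrow> bool" where
  "continuous_state L \<theta> u \<longleftrightarrow>
     continuous_on {0..} \<theta> \<and>
     (\<forall>t\<ge>0. L2_on L (u t)) \<and>
     (\<forall>t\<ge>0. ((\<lambda>s. LINT x|lebesgue_on {0..L}. (u s x - u t x)\<^sup>2) \<longlongrightarrow> 0) (at t within {0..}))"

text \<open>
  Test functions for the heat equation: \<open>\<phi>\<close> is \<open>C\<^sup>2\<close> in \<open>x\<close> and \<open>C\<^sup>1\<close> in \<open>t\<close> on
  \<open>[0,L] \<times> [0,\<infinity>)\<close>, with partial derivatives \<open>\<phi>x\<close>, \<open>\<phi>xx\<close>, \<open>\<phi>t\<close>, and satisfies the homogeneous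
  boundary conditions \<open>\<phi>x(0,t) = 0\<close> and \<open>\<phi>(L,t) = 0\<close>. Arguments are in the order \<open>t\<close>, \<open>x\<close>.
\<close>

definition test_function ::
  "real \<Rightarrow> (real \<Rightarrow> real \<Rightarrow> real) \<Rightarrow> (real \<Rightarrow> real \<Rightarrow> real) \<Rightarrow> (real \<Rightarrow> real \<Rightarrow> real) \<Rightarrow>
    (real \<Rightarrow> real \<Rightarrow> real) \<Rightarrow> bool" where
  "test_function L \<phi> \<phi>x \<phi>xx \<phi>t \<longleftrightarrow>
     (\<forall>t\<ge>0. \<forall>x\<in>{0..L}.
        ((\<lambda>y. \<phi> t y) has_real_derivative \<phi>x t x) (at x within {0..L}) \<and>
        ((\<lambda>y. \<phi>x t y) has_real_derivative \<phi>xx t x) (at x within {0..L}) \<and>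
        ((\<lambda>s. \<phi> s x) has_real_derivative \<phi>t t x) (at t within {0..})) \<and>
     continuous_on ({0..} \<times> {0..L}) (\<lambda>(t, x). \<phi> t x) \<and>
     continuous_on ({0..} \<times> {0..L}) (\<lambda>(t, x). \<phi>x t x) \<and>
     continuous_on ({0..} \<times> {0..L}) (\<lambda>(t, x). \<phi>xx t x) \<and>
     continuous_on ({0..} \<times> {0..L}) (\<lambda>(t, x). \<phi>t t x) \<and>
     (\<forall>t\<ge>0. \<phi>x t 0 = 0 \<and> \<phi> t L = 0)"

text \<open>
  Weak form of \<open>u\<^sub>t = u\<^sub>x\<^sub>x\<close>, \<open>u\<^sub>x(0,t) = 0\<close>, \<open>u(L,t) = U t\<close>, for \<open>u\<close> continuous in time with
  values in \<open>L\<^sup>2(0,L)\<close>: multiply by \<open>\<phi>\<close>, integrate over \<open>[0,L] \<times> [0,T]\<close> and integrate by parts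
  once in \<open>t\<close> and twice in \<open>x\<close>. By the boundary conditions on \<open>u\<close> and \<open>\<phi>\<close>, the only boundary
  term in \<open>x\<close> that survives is \<open>- U t * \<phi>x(L,t)\<close>.
\<close>

definition weak_heat_solution ::
  "real \<Rightarrow> (real \<Rightarrow> real) \<Rightarrow> (real \<Rightarrow> real \<Rightarrow> real) \<Rightarrow> bool" where
  "weak_heat_solution L U u \<longleftrightarrow>
     (\<forall>\<phi> \<phi>x \<phi>xx \<phi>t. test_function L \<phi> \<phi>x \<phi>xx \<phi>t \<longrightarrow>
       (\<forall>T\<ge>0.
          (LINT x|lebesgue_on {0..L}. u T x * \<phi> T x) - (LINT x|lebesgue_on {0..L}. u 0 x * \<phi> 0 x)
          = (LINT t|lebesgue_on {0..T}.
               (LINT x|lebesgue_on {0..L}. u t x * (\<phi>t t x + \<phi>xx t x)) - U t * \<phi>x t L)))"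

text \<open>
  The right-hand side of the ODE is continuous in \<open>t\<close> for a continuous state, so the ODE holds
  classically, with a one-sided derivative at \<open>0\<close>.
\<close>

definition cascade_solution ::
  "real \<Rightarrow> (real \<Rightarrow> real) \<Rightarrow> (real \<Rightarrow> real) \<Rightarrow> (real \<Rightarrow> real \<Rightarrow> real) \<Rightarrow> bool" where
  "cascade_solution L U \<theta> u \<longleftrightarrow>
     continuous_state L \<theta> u \<and>
     (\<forall>t\<ge>0. (\<theta> has_real_derivative (LINT y|lebesgue_on {0..L}. u t y)) (at t within {0..})) \<and>
     weak_heat_solution L U u"

definition g_kernel :: "real \<Rightarrow> real \<Rightarrow> real" where
  "g_kernel L x = 1/2 * (L\<^sup>2 - x\<^sup>2)"

definition Z_state :: "real \<Rightarrow> (real \<Rightarrow> real) \<Rightarrow> (real \<Rightarrow> real \<Rightarrow> real) \<Rightarrow> real \<Rightarrow> real" where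
  "Z_state L \<theta> u t = \<theta> t + (LINT y|lebesgue_on {0..L}. g_kernel L y * u t y)"

definition closed_loop_solution ::
  "real \<Rightarrow> real \<Rightarrow> real \<Rightarrow> (real \<Rightarrow> real) \<Rightarrow> (real \<Rightarrow> real) \<Rightarrow> (real \<Rightarrow> real \<Rightarrow> real) \<Rightarrow> bool" where
  "closed_loop_solution L K \<theta>0 u0 \<theta> u \<longleftrightarrow>
     cascade_solution L (\<lambda>t. K * Z_state L \<theta> u t) \<theta> u \<and>
     \<theta> 0 = \<theta>0 \<and> (AE x in lebesgue_on {0..L}. u 0 x = u0 x)"

definition Omega :: "real \<Rightarrow> (real \<Rightarrow> real) \<Rightarrow> (real \<Rightarrow> real \<Rightarrow> real) \<Rightarrow> real \<Rightarrow> real" where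
  "Omega L \<theta> u t = \<bar>\<theta> t\<bar>\<^sup>2 + (LINT x|lebesgue_on {0..L}. (u t x)\<^sup>2)"

end

theory Submission
  imports Defs
begin

text \<open>
The two feedback terms in \<open>Z\<close> are chosen so that the heat equation disappears from its evolution.
The kernel \<open>g\<close> satisfies \<open>g'' = -1\<close>, \<open>g'(0) = 0\<close> and \<open>g(L) = 0\<close>, so it is an admissible
time-independent test function, and testing with it gives
\<open>d/dt \<integral> g u = - \<integral> u + L U\<close>. The mean of \<open>u\<close> cancels against the ODE for \<open>\<theta>\<close>, which leaves
\<open>Z' = L U = L K Z\<close> (\<open>cascade_Z_state_derivative\<close>), hence \<open>Z(t) = Z(0) exp (L K t)\<close>. The boundary
input \<open>U = K Z\<close> of the heat equation is therefore a known decaying exponential, fixed by the initial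
data, and \<open>\<theta> = Z - \<integral> g u\<close> is recovered from \<open>u\<close>.

The heat equation with this input is solved by \<open>u = w + v\<close>. With \<open>\<mu>\<^sup>2 = - L K\<close>, the separated solution
\<open>w(x,t) = K Z(0) exp (L K t) cos (\<mu> x) / cos (\<mu> L)\<close> carries the boundary value; it exists because the
excluded gains are exactly those with \<open>cos (\<mu> L) = 0\<close> (\<open>cos_at_L_nonzero\<close>). The remainder \<open>v\<close> solves
the heat equation with homogeneous boundary conditions and is the eigenfunction series
\<open>\<Sum>n. exp (- \<omega>\<^sub>n\<^sup>2 t) c\<^sub>n e\<^sub>n\<close>, where \<open>e\<^sub>n\<close> is proportional to \<open>cos (\<omega>\<^sub>n x)\<close> with
\<open>\<omega>\<^sub>n = (2 n + 1) \<pi> / (2 L)\<close>.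

Everything about \<open>v\<close> rests on the Parseval identity for the system \<open>e\<^sub>n\<close> (\<open>cos_mode_Parseval\<close>).
Comparing coefficients yields decay at rate \<open>\<omega>\<^sub>0\<^sup>2\<close> (\<open>heat_flow_decay\<close>) and continuity in \<open>L\<^sup>2\<close>, and it
bounds the distance to the partial sums uniformly in time, so that the weak formulation passes from the
finite sums to the limit (\<open>heat_flow_heat_trajectory\<close>). Uniqueness (\<open>heat_trajectory_unique\<close>) is obtained by
testing with \<open>exp (\<omega>\<^sub>n\<^sup>2 t) e\<^sub>n(x)\<close>, which solves the adjoint equation: every Fourier coefficient of a weak
solution is determined by the initial value and the input, and by Parseval the coefficients determine the
function. Every closed-loop solution thus coincides with the explicit one
(\<open>closed_loop_solution_formula\<close>), and the exponential estimate is read off from the formula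
(\<open>closed_loop_state_decay\<close>).
\<close>

section \<open>The inner product of square-integrable functions\<close>

definition inner_L2 :: "real \<Rightarrow> (real \<Rightarrow> real) \<Rightarrow> (real \<Rightarrow> real) \<Rightarrow> real" where
  "inner_L2 L f g = (LINT x|lebesgue_on {0..L}. f x * g x)"

lemma L2_on_measurable: "L2_on L f \<Longrightarrow> f \<in> borel_measurable (lebesgue_on {0..L})"
  by (simp add: L2_on_def)

lemma L2_on_integrable_mult:
  assumes "L2_on L f" "L2_on L g"
  shows "integrable (lebesgue_on {0..L}) (\<lambda>x. f x * g x)"
proof (rule Bochner_Integration.integrable_bound)
  show "integrable (lebesgue_on {0..L}) (\<lambda>x. (f x)\<^sup>2 + (g x)\<^sup>2)"
    using assms by (simp add: L2_on_def)
  show "(\<lambda>x. f x * g x) \<in> borel_measurable (lebesgue_on {0..L})"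
    using assms by (auto simp: L2_on_def)
  have "\<bar>a * b\<bar> \<le> a\<^sup>2 + b\<^sup>2" for a b :: real
    using sum_squares_bound[of "\<bar>a\<bar>" "\<bar>b\<bar>"] abs_ge_zero[of "a*b"]
    unfolding abs_mult power2_abs by linarith
  then show "AE x in lebesgue_on {0..L}. norm (f x * g x) \<le> norm ((f x)\<^sup>2 + (g x)\<^sup>2)"
    by (auto intro!: AE_I2 order_trans[OF _ abs_ge_self])
qed

lemma L2_on_cmult: "L2_on L f \<Longrightarrow> L2_on L (\<lambda>x. c * f x)"
  by (auto simp: L2_on_def power_mult_distrib)

lemma L2_on_add:
  assumes "L2_on L f" "L2_on L g"
  shows "L2_on L (\<lambda>x. f x + g x)"
proof -
  have "integrable (lebesgue_on {0..L}) (\<lambda>x. (f x)\<^sup>2 + (g x)\<^sup>2 + 2 * (f x * g x))"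
    using assms L2_on_integrable_mult[OF assms] by (auto simp: L2_on_def)
  then have "integrable (lebesgue_on {0..L}) (\<lambda>x. (f x + g x)\<^sup>2)"
    by (simp add: power2_sum mult.assoc)
  then show ?thesis using assms by (auto simp: L2_on_def)
qed

lemma L2_on_diff: "L2_on L f \<Longrightarrow> L2_on L g \<Longrightarrow> L2_on L (\<lambda>x. f x - g x)"
  using L2_on_add[of L f "\<lambda>x. -1 * g x"] L2_on_cmult[of L g "-1"] by simp

lemma L2_on_sum:
  assumes "\<And>i. i \<in> I \<Longrightarrow> L2_on L (f i)"
  shows "L2_on L (\<lambda>x. \<Sum>i\<in>I. f i x)"
proof -
  have "L2_on L (\<lambda>x. 0)" by (simp add: L2_on_def)
  then show ?thesis using assms
    by (induction I rule: infinite_finite_induct) (auto intro: L2_on_add)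
qed

lemma L2_on_continuous:
  assumes "continuous_on {0..L} f"
  shows "L2_on L f"
  unfolding L2_on_def
  by (intro conjI borel_measurable_integrable continuous_imp_integrable_real
      continuous_on_power assms)

lemma inner_L2_commute: "inner_L2 L f g = inner_L2 L g f"
  by (simp add: inner_L2_def mult.commute)

lemma inner_L2_self: "inner_L2 L f f = (LINT x|lebesgue_on {0..L}. (f x)\<^sup>2)"
  by (simp add: inner_L2_def power2_eq_square)

lemma inner_L2_self_nonneg: "0 \<le> inner_L2 L f f"
  by (simp add: inner_L2_self)

lemma inner_L2_add_left:
  assumes "L2_on L f" "L2_on L g" "L2_on L h"
  shows "inner_L2 L (\<lambda>x. f x + g x) h = inner_L2 L f h + inner_L2 L g h"
  using assms unfolding inner_L2_def
  by (simp add: distrib_right L2_on_integrable_mult)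

lemma inner_L2_cmult_left: "inner_L2 L (\<lambda>x. c * f x) h = c * inner_L2 L f h"
  unfolding inner_L2_def by (simp add: mult.assoc)

lemma inner_L2_cmult_right: "inner_L2 L h (\<lambda>x. c * f x) = c * inner_L2 L h f"
  by (simp add: inner_L2_commute[of L h] inner_L2_cmult_left)

lemma inner_L2_diff_left:
  assumes "L2_on L f" "L2_on L g" "L2_on L h"
  shows "inner_L2 L (\<lambda>x. f x - g x) h = inner_L2 L f h - inner_L2 L g h"
  using assms unfolding inner_L2_def
  by (simp add: left_diff_distrib L2_on_integrable_mult)

lemma inner_L2_diff_right:
  assumes "L2_on L f" "L2_on L g" "L2_on L h"
  shows "inner_L2 L h (\<lambda>x. f x - g x) = inner_L2 L h f - inner_L2 L h g"
  using inner_L2_diff_left[OF assms] by (simp add: inner_L2_commute[of L h])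

lemma inner_L2_sum_left:
  assumes "\<And>i. i \<in> I \<Longrightarrow> L2_on L (f i)" "L2_on L h"
  shows "inner_L2 L (\<lambda>x. \<Sum>i\<in>I. f i x) h = (\<Sum>i\<in>I. inner_L2 L (f i) h)"
  using assms unfolding inner_L2_def
  by (simp add: sum_distrib_right L2_on_integrable_mult)

lemma inner_L2_cong_AE:
  assumes "L2_on L f" "L2_on L g" "L2_on L h" "AE x in lebesgue_on {0..L}. f x = g x"
  shows "inner_L2 L f h = inner_L2 L g h"
  unfolding inner_L2_def using assms
  by (intro integral_cong_AE) (auto simp: L2_on_def)

lemma inner_L2_self_diff:
  assumes "L2_on L f" "L2_on L g"
  shows "inner_L2 L (\<lambda>x. f x - g x) (\<lambda>x. f x - g x)
    = inner_L2 L f f - 2 * inner_L2 L f g + inner_L2 L g g"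
  using assms
  by (simp add: inner_L2_diff_left inner_L2_diff_right L2_on_diff inner_L2_commute[of L g f])

text \<open>
\<open>\<parallel>a f - b g\<parallel>\<^sup>2\<close> is a nonnegative quadratic form in \<open>(a, b)\<close>, so its discriminant is nonpositive. If
\<open>\<parallel>f\<parallel> = 0\<close>, the form is linear in \<open>a\<close> and nonnegativity forces the mixed term to vanish.
\<close>

lemma inner_L2_Cauchy_Schwarz:
  assumes "L2_on L f" "L2_on L g"
  shows "(inner_L2 L f g)\<^sup>2 \<le> inner_L2 L f f * inner_L2 L g g"
proof -
  let ?F = "inner_L2 L f f" and ?G = "inner_L2 L g g" and ?I = "inner_L2 L f g"
  have q: "0 \<le> a\<^sup>2 * ?F - 2 * (a * b) * ?I + b\<^sup>2 * ?G" for a b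
  proof -
    have "0 \<le> inner_L2 L (\<lambda>x. a * f x - b * g x) (\<lambda>x. a * f x - b * g x)"
      by (rule inner_L2_self_nonneg)
    also have "\<dots> = a\<^sup>2 * ?F - 2 * (a * b) * ?I + b\<^sup>2 * ?G"
      using assms
      by (subst inner_L2_self_diff)
        (simp_all add: L2_on_cmult inner_L2_cmult_left inner_L2_cmult_right power2_eq_square)
    finally show ?thesis .
  qed
  show ?thesis
  proof (cases "?F = 0")
    case True
    have "?I = 0"
    proof (rule ccontr)
      assume ne: "?I \<noteq> 0"
      then show False
        using q[of "(?G + 1) / (2 * ?I)" 1] True by (simp add: field_simps)
    qed
    then show ?thesis using True by simp
  next
    case False
    then have F: "?F > 0" using inner_L2_self_nonneg[of L f] by linarith
    have "0 \<le> ?I\<^sup>2 * ?F - 2 * (?I * ?F) * ?I + ?F\<^sup>2 * ?G" by (rule q)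
    also have "\<dots> = ?F * (?F * ?G - ?I\<^sup>2)" by (simp add: power2_eq_square algebra_simps)
    finally have "0 \<le> ?F * ?G - ?I\<^sup>2" using F by (simp add: zero_le_mult_iff)
    then show ?thesis by simp
  qed
qed

lemma abs_inner_L2_le:
  assumes "L2_on L f" "L2_on L g"
  shows "\<bar>inner_L2 L f g\<bar> \<le> sqrt (inner_L2 L f f) * sqrt (inner_L2 L g g)"
proof -
  have "\<bar>inner_L2 L f g\<bar> = sqrt ((inner_L2 L f g)\<^sup>2)" by simp
  also have "\<dots> \<le> sqrt (inner_L2 L f f * inner_L2 L g g)"
    using inner_L2_Cauchy_Schwarz[OF assms] by (rule real_sqrt_le_mono)
  finally show ?thesis by (simp add: real_sqrt_mult)
qed

lemma inner_L2_self_add_le: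
  assumes "L2_on L f" "L2_on L g"
  shows "inner_L2 L (\<lambda>x. f x + g x) (\<lambda>x. f x + g x) \<le> 2 * inner_L2 L f f + 2 * inner_L2 L g g"
proof -
  have le: "(a + b)\<^sup>2 \<le> 2 * a\<^sup>2 + 2 * b\<^sup>2" for a b :: real
    using sum_squares_bound[of a b] by (simp add: power2_sum)
  have "inner_L2 L (\<lambda>x. f x + g x) (\<lambda>x. f x + g x)
      \<le> (LINT x|lebesgue_on {0..L}. 2 * (f x)\<^sup>2 + 2 * (g x)\<^sup>2)"
    unfolding inner_L2_self
    by (rule integral_mono) (use assms L2_on_add[OF assms] le in \<open>auto simp: L2_on_def\<close>)
  also have "\<dots> = 2 * inner_L2 L f f + 2 * inner_L2 L g g"
    using assms by (simp add: inner_L2_self L2_on_def)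
  finally show ?thesis .
qed

lemma inner_L2_self_add3_le:
  assumes "L2_on L f" "L2_on L g" "L2_on L h"
  shows "inner_L2 L (\<lambda>x. f x + (g x + h x)) (\<lambda>x. f x + (g x + h x))
    \<le> 2 * inner_L2 L f f + 4 * inner_L2 L g g + 4 * inner_L2 L h h"
proof -
  let ?k = "\<lambda>x. g x + h x"
  have "inner_L2 L (\<lambda>x. f x + ?k x) (\<lambda>x. f x + ?k x) \<le> 2 * inner_L2 L f f + 2 * inner_L2 L ?k ?k"
    by (rule inner_L2_self_add_le[OF assms(1) L2_on_add[OF assms(2,3)]])
  also have "\<dots> \<le> 2 * inner_L2 L f f + 2 * (2 * inner_L2 L g g + 2 * inner_L2 L h h)"
    by (intro add_left_mono mult_left_mono inner_L2_self_add_le[OF assms(2,3)]) simp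
  finally show ?thesis by simp
qed

lemma inner_L2_self_eq_0_AE:
  assumes "L2_on L f" "inner_L2 L f f = 0"
  shows "AE x in lebesgue_on {0..L}. f x = 0"
  using assms integral_nonneg_eq_0_iff_AE[of "lebesgue_on {0..L}" "\<lambda>x. (f x)\<^sup>2"]
  by (simp add: inner_L2_self L2_on_def)

lemma inner_L2_continuous:
  assumes "continuous_on {0..L} f" "continuous_on {0..L} g"
  shows "inner_L2 L f g = integral {0..L} (\<lambda>x. f x * g x)"
  unfolding inner_L2_def
  by (intro lebesgue_integral_eq_integral continuous_imp_integrable_real continuous_on_mult assms)
    simp

lemma inner_L2_self_le_bound:
  assumes "0 \<le> L" "L2_on L f" "\<And>x. x \<in> {0..L} \<Longrightarrow> \<bar>f x\<bar> \<le> B"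
  shows "inner_L2 L f f \<le> L * B\<^sup>2"
proof -
  have "inner_L2 L f f \<le> (LINT x|lebesgue_on {0..L}. B\<^sup>2)"
    unfolding inner_L2_self
  proof (rule integral_mono)
    fix x assume "x \<in> space (lebesgue_on {0..L})"
    then have "\<bar>f x\<bar> \<le> B" using assms(3) by simp
    then show "(f x)\<^sup>2 \<le> B\<^sup>2" by (simp add: abs_le_square_iff[symmetric])
  next
    show "integrable (lebesgue_on {0..L}) (\<lambda>x. (f x)\<^sup>2)" using assms by (simp add: L2_on_def)
    show "integrable (lebesgue_on {0..L}) (\<lambda>x. B\<^sup>2)"
      by (intro continuous_imp_integrable_real continuous_on_const)
  qed
  also have "\<dots> = L * B\<^sup>2" using assms(1) by (simp add: measure_restrict_space)
  finally show ?thesis .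
qed

section \<open>The quarter-wave cosine system\<close>

text \<open>
The square roots \<open>\<omega>\<^sub>n\<close> of the eigenvalues of \<open>- d\<^sup>2/dx\<^sup>2\<close> for vanishing slope at \<open>0\<close> and vanishing value
at \<open>L\<close>.
\<close>

definition freq :: "real \<Rightarrow> nat \<Rightarrow> real" where
  "freq L n = (2 * real n + 1) * (pi / (2 * L))"

definition cos_mode :: "real \<Rightarrow> nat \<Rightarrow> real \<Rightarrow> real" where
  "cos_mode L n x = sqrt (2 / L) * cos (freq L n * x)"

lemma continuous_on_cos_mode [continuous_intros]: "continuous_on S (cos_mode L n)"
  unfolding cos_mode_def by (intro continuous_intros)

lemma L2_on_cos_mode [simp]: "L2_on L (cos_mode L n)"
  by (intro L2_on_continuous continuous_on_cos_mode)

lemma integral_cos_multiple_pi: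
  fixes m :: int
  assumes "L > 0" "m \<noteq> 0"
  shows "((\<lambda>x. cos (of_int m * (pi / L) * x)) has_integral 0) {0..L}"
proof -
  let ?c = "of_int m * (pi / L)"
  have c: "?c \<noteq> 0" using assms by simp
  have "((\<lambda>x. cos (?c * x)) has_integral (sin (?c * L) / ?c - sin (?c * 0) / ?c)) {0..L}"
    using c assms
    by (intro fundamental_theorem_of_calculus)
      (auto intro!: derivative_eq_intros simp: has_real_derivative_iff_has_vector_derivative[symmetric])
  moreover have "sin (?c * L) = 0"
    using assms sin_zero_iff_int2[of "?c * L"] by auto
  ultimately show ?thesis by simp
qed

text \<open>
Sums and differences of the half-odd frequencies are integer multiples of \<open>\<pi> / L\<close>, whose cosines
have mean zero over \<open>[0, L]\<close>, except for the zero multiple, which occurs only if \<open>n = m\<close>.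
\<close>

lemma cos_mode_orthonormal:
  assumes L: "L > 0"
  shows "inner_L2 L (cos_mode L n) (cos_mode L m) = (if n = m then 1 else 0)"
proof -
  let ?k1 = "int n - int m" and ?k2 = "int n + int m + 1"
  have prod: "cos_mode L n x * cos_mode L m x
      = (1 / L) * (cos (of_int ?k1 * (pi / L) * x) + cos (of_int ?k2 * (pi / L) * x))" for x
  proof -
    have f: "freq L n * x - freq L m * x = of_int ?k1 * (pi / L) * x"
      "freq L n * x + freq L m * x = of_int ?k2 * (pi / L) * x"
      unfolding freq_def using L by (simp_all add: field_simps)
    have "cos_mode L n x * cos_mode L m x
        = (sqrt (2 / L) * sqrt (2 / L)) * (cos (freq L n * x) * cos (freq L m * x))"
      unfolding cos_mode_def by (simp only: mult_ac)
    also have "\<dots> = (2 / L) * ((cos (freq L n * x - freq L m * x) + cos (freq L n * x + freq L m * x)) / 2)"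
    proof -
      have "sqrt (2 / L) * sqrt (2 / L) = 2 / L" using L by simp
      then show ?thesis by (simp only: cos_times_cos)
    qed
    also have "\<dots> = (1 / L) * (cos (freq L n * x - freq L m * x) + cos (freq L n * x + freq L m * x))"
      using L by (simp add: field_simps)
    finally show ?thesis unfolding f .
  qed
  have I2: "((\<lambda>x. cos (of_int ?k2 * (pi / L) * x)) has_integral 0) {0..L}"
    by (rule integral_cos_multiple_pi[OF L]) simp
  have I1: "((\<lambda>x. cos (of_int ?k1 * (pi / L) * x)) has_integral (if n = m then L else 0)) {0..L}"
  proof (cases "n = m")
    case True
    then show ?thesis using has_integral_const_real[of "1::real" 0 L] L by simp
  next
    case False
    then show ?thesis using integral_cos_multiple_pi[OF L, of ?k1] by simp
  qed
  have "((\<lambda>x. cos_mode L n x * cos_mode L m x) has_integral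
      (1 / L) * ((if n = m then L else 0) + 0)) {0..L}"
    unfolding prod by (intro has_integral_mult_right has_integral_add I1 I2)
  then show ?thesis using L
    by (simp add: inner_L2_continuous continuous_on_cos_mode integral_unique)
qed

definition fourier_remainder :: "real \<Rightarrow> nat \<Rightarrow> (real \<Rightarrow> real) \<Rightarrow> real \<Rightarrow> real" where
  "fourier_remainder L N f x = f x - (\<Sum>n<N. inner_L2 L f (cos_mode L n) * cos_mode L n x)"

lemma L2_on_fourier_remainder:
  "L2_on L f \<Longrightarrow> L2_on L (fourier_remainder L N f)"
  unfolding fourier_remainder_def
  by (intro L2_on_diff L2_on_sum L2_on_cmult) simp_all

lemma inner_L2_cos_sum:
  assumes "L > 0"
  shows "inner_L2 L (\<lambda>x. \<Sum>n<N. a n * cos_mode L n x) (cos_mode L m)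
    = (if m < N then a m else 0)"
proof -
  have "inner_L2 L (\<lambda>x. \<Sum>n<N. a n * cos_mode L n x) (cos_mode L m)
      = (\<Sum>n<N. a n * (if n = m then 1 else 0))"
    using assms
    by (subst inner_L2_sum_left) (simp_all add: L2_on_cmult inner_L2_cmult_left cos_mode_orthonormal)
  then show ?thesis by (simp add: sum.delta if_distrib cong: if_cong)
qed

lemma inner_L2_cos_sum_right:
  assumes "L2_on L f"
  shows "inner_L2 L f (\<lambda>x. \<Sum>n<N. a n * cos_mode L n x)
    = (\<Sum>n<N. a n * inner_L2 L f (cos_mode L n))"
  using assms
  by (subst inner_L2_commute, subst inner_L2_sum_left)
    (simp_all add: L2_on_cmult inner_L2_cmult_left inner_L2_commute[of L f])

text \<open>
By orthonormality the partial sum is the orthogonal projection of \<open>f\<close> on the first \<open>N\<close> modes, so the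
theorem of Pythagoras applies.
\<close>

lemma fourier_remainder_energy:
  assumes L: "L > 0" and f: "L2_on L f"
  shows "inner_L2 L (fourier_remainder L N f) (fourier_remainder L N f)
    = inner_L2 L f f - (\<Sum>n<N. (inner_L2 L f (cos_mode L n))\<^sup>2)"
proof -
  let ?s = "\<lambda>x. \<Sum>n<N. inner_L2 L f (cos_mode L n) * cos_mode L n x"
  have s: "L2_on L ?s" by (intro L2_on_sum L2_on_cmult) simp
  have "inner_L2 L ?s ?s = (\<Sum>n<N. (inner_L2 L f (cos_mode L n))\<^sup>2)"
    using inner_L2_cos_sum_right[OF s] inner_L2_cos_sum[OF L]
    by (simp add: power2_eq_square)
  moreover have "inner_L2 L f ?s = (\<Sum>n<N. (inner_L2 L f (cos_mode L n))\<^sup>2)"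
    using inner_L2_cos_sum_right[OF f] by (simp add: power2_eq_square)
  ultimately show ?thesis
    unfolding fourier_remainder_def using inner_L2_self_diff[OF f s] by simp
qed

lemma Bessel_partial:
  assumes "L > 0" "L2_on L f"
  shows "(\<Sum>n<N. (inner_L2 L f (cos_mode L n))\<^sup>2) \<le> inner_L2 L f f"
  using fourier_remainder_energy[OF assms, of N] inner_L2_self_nonneg[of L "fourier_remainder L N f"]
  by simp

lemma fourier_remainder_add:
  assumes "L2_on L f" "L2_on L g"
  shows "fourier_remainder L N (\<lambda>x. f x + g x)
    = (\<lambda>x. fourier_remainder L N f x + fourier_remainder L N g x)"
  using assms
  by (simp add: fourier_remainder_def inner_L2_add_left distrib_right sum.distrib fun_eq_iff)

lemma fourier_remainder_cmult:
  "fourier_remainder L N (\<lambda>x. c * f x) = (\<lambda>x. c * fourier_remainder L N f x)"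
  by (simp add: fourier_remainder_def inner_L2_cmult_left right_diff_distrib sum_distrib_left
      mult.assoc fun_eq_iff)

lemma fourier_remainder_cos_mode:
  assumes "L > 0" "n < N"
  shows "fourier_remainder L N (cos_mode L n) = (\<lambda>x. 0)"
  using assms
  by (simp add: fourier_remainder_def cos_mode_orthonormal fun_eq_iff if_distrib[of "\<lambda>c. c * _"]
      cong: if_cong)

text \<open>
Passing to the Fourier remainder is linear and does not increase the norm. Applied to \<open>f - q\<close>, where \<open>q\<close>
has no remainder from some index on, it shows that the remainder of \<open>f\<close> is eventually no larger in norm than
\<open>f - q\<close>. Approximability by finite mode combinations is therefore all that Parseval's identity needs.
\<close>

lemma Parseval_from_approximation:
  assumes L: "L > 0" and f: "L2_on L f"
    and approx: "\<And>\<epsilon>. \<epsilon> > 0 \<Longrightarrow> \<exists>q N. L2_on L q \<and> (\<forall>M\<ge>N. fourier_remainder L M q = (\<lambda>x. 0)) \<and>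
      inner_L2 L (\<lambda>x. f x - q x) (\<lambda>x. f x - q x) < \<epsilon>"
  shows "(\<lambda>n. (inner_L2 L f (cos_mode L n))\<^sup>2) sums inner_L2 L f f"
  unfolding sums_def
proof (rule LIMSEQ_I)
  fix \<epsilon> :: real assume "\<epsilon> > 0"
  then obtain q N where q: "L2_on L q" and N: "\<And>M. M \<ge> N \<Longrightarrow> fourier_remainder L M q = (\<lambda>x. 0)"
    and e: "inner_L2 L (\<lambda>x. f x - q x) (\<lambda>x. f x - q x) < \<epsilon>"
    using approx by metis
  have "norm ((\<Sum>n<M. (inner_L2 L f (cos_mode L n))\<^sup>2) - inner_L2 L f f) < \<epsilon>" if "M \<ge> N" for M
  proof -
    have d: "L2_on L (\<lambda>x. f x - q x)" using f q by (rule L2_on_diff)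
    have "fourier_remainder L M f = fourier_remainder L M (\<lambda>x. f x - q x)"
      using fourier_remainder_add[OF d q, of M] N[OF that] by simp
    then have "inner_L2 L f f - (\<Sum>n<M. (inner_L2 L f (cos_mode L n))\<^sup>2)
        \<le> inner_L2 L (\<lambda>x. f x - q x) (\<lambda>x. f x - q x)"
      using fourier_remainder_energy[OF L f, of M] fourier_remainder_energy[OF L d, of M]
      using sum_nonneg[of "{..<M}" "\<lambda>n. (inner_L2 L (\<lambda>x. f x - q x) (cos_mode L n))\<^sup>2"] by simp
    moreover have "(\<Sum>n<M. (inner_L2 L f (cos_mode L n))\<^sup>2) \<le> inner_L2 L f f"
      by (rule Bessel_partial[OF L f])
    ultimately show ?thesis using e by simp
  qed
  then show "\<exists>N. \<forall>M\<ge>N. norm ((\<Sum>n<M. (inner_L2 L f (cos_mode L n))\<^sup>2) - inner_L2 L f f) < \<epsilon>"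
    by blast
qed

text \<open>
The linear span of the modes, as an inductive predicate: closure properties of the span are then proved by
rule induction, without handling coefficient sequences.
\<close>

inductive cosine_sum :: "real \<Rightarrow> (real \<Rightarrow> real) \<Rightarrow> bool" for L where
  mode: "cosine_sum L (cos_mode L n)"
| scale: "cosine_sum L h \<Longrightarrow> cosine_sum L (\<lambda>x. c * h x)"
| add: "cosine_sum L h \<Longrightarrow> cosine_sum L k \<Longrightarrow> cosine_sum L (\<lambda>x. h x + k x)"

lemma cosine_sum_remainder:
  assumes "L > 0" "cosine_sum L h"
  shows "L2_on L h \<and> (\<exists>N. \<forall>M\<ge>N. fourier_remainder L M h = (\<lambda>x. 0))"
  using assms(2)
proof induction
  case (mode n)
  have "\<forall>M\<ge>Suc n. fourier_remainder L M (cos_mode L n) = (\<lambda>x. 0)"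
    using fourier_remainder_cos_mode[OF assms(1)] by auto
  then show ?case by (auto intro!: exI[of _ "Suc n"])
next
  case (scale h c)
  then obtain N where "\<forall>M\<ge>N. fourier_remainder L M h = (\<lambda>x. 0)" by blast
  then have "\<forall>M\<ge>N. fourier_remainder L M (\<lambda>x. c * h x) = (\<lambda>x. 0)"
    by (simp add: fourier_remainder_cmult)
  then show ?case using scale.IH by (blast intro: L2_on_cmult)
next
  case (add h k)
  then obtain N1 N2 where "\<forall>M\<ge>N1. fourier_remainder L M h = (\<lambda>x. 0)"
    "\<forall>M\<ge>N2. fourier_remainder L M k = (\<lambda>x. 0)" by blast
  then have "\<forall>M\<ge>max N1 N2. fourier_remainder L M (\<lambda>x. h x + k x) = (\<lambda>x. 0)"
    using add.IH by (simp add: fourier_remainder_add)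
  then show ?case using add.IH by (blast intro: L2_on_add)
qed

definition quarter_cos :: "real \<Rightarrow> real \<Rightarrow> real" where
  "quarter_cos L x = cos (pi / (2 * L) * x)"

text \<open>
The span of the modes is not an algebra: its members vanish at \<open>L\<close>, and products of two modes leave it. It
is, however, a module over the polynomials in \<open>cos\<^sup>2 (\<pi> x / (2 L))\<close>. The case \<open>n = 0\<close> is covered by
truncated subtraction, because the mode of index \<open>-1\<close> has the opposite frequency of mode \<open>0\<close> and so is the
same function.
\<close>

lemma quarter_cos_sq_mult_cos_mode:
  "(quarter_cos L x)\<^sup>2 * cos_mode L n x
    = 1/4 * (cos_mode L (n - 1) x + (2 * cos_mode L n x + cos_mode L (Suc n) x))"
proof -
  define b where "b = pi / (2 * L) * x"
  have freq: "freq L k * x = (2 * real k + 1) * b" for k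
    by (simp only: freq_def b_def mult.assoc)
  have sq: "(cos b)\<^sup>2 = (1 + cos (2 * b)) / 2"
    by (simp add: cos_double_cos)
  have "freq L (Suc n) * x = freq L n * x + 2 * b"
    unfolding freq by (simp add: algebra_simps)
  then have s: "cos (freq L (Suc n) * x)
      = cos (freq L n * x) * cos (2 * b) - sin (freq L n * x) * sin (2 * b)"
    by (simp only: cos_add)
  have "cos (freq L (n - 1) * x) = cos (freq L n * x - 2 * b)"
  proof (cases n)
    case 0
    have "freq L n * x - 2 * b = - (freq L (n - 1) * x)" unfolding freq 0 by simp
    then show ?thesis by (simp only: cos_minus)
  next
    case (Suc m)
    then have "freq L (n - 1) * x = freq L n * x - 2 * b"
      unfolding freq by (simp add: algebra_simps)
    then show ?thesis by (simp only:)
  qed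
  then have p: "cos (freq L (n - 1) * x)
      = cos (freq L n * x) * cos (2 * b) + sin (freq L n * x) * sin (2 * b)"
    by (simp only: cos_diff)
  have "quarter_cos L x = cos b" by (simp only: quarter_cos_def b_def)
  then show ?thesis
    unfolding cos_mode_def s p by (simp add: sq algebra_simps)
qed

lemma quarter_cos_bounds:
  assumes "L > 0" "0 \<le> x" "x < L"
  shows "0 < quarter_cos L x"
proof -
  have "pi / (2 * L) * x < pi / 2" using assms by (simp add: field_simps)
  moreover have "0 \<le> pi / (2 * L) * x" using assms by simp
  ultimately show ?thesis unfolding quarter_cos_def by (intro cos_gt_zero_pi) (use pi_gt_zero in linarith)+
qed

lemma quarter_cos_sq_inj:
  assumes "L > 0" "x \<in> {0..L}" "y \<in> {0..L}" "(quarter_cos L x)\<^sup>2 = (quarter_cos L y)\<^sup>2"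
  shows "x = y"
proof -
  have ran: "0 \<le> 2 * (pi / (2 * L) * z) \<and> 2 * (pi / (2 * L) * z) \<le> pi" if "z \<in> {0..L}" for z
    using that assms(1) by (auto simp: field_simps)
  have "cos (2 * (pi / (2 * L) * x)) = cos (2 * (pi / (2 * L) * y))"
    using assms(4) unfolding quarter_cos_def by (simp only: cos_double_cos)
  then have "2 * (pi / (2 * L) * x) = 2 * (pi / (2 * L) * y)"
    using ran[OF assms(2)] ran[OF assms(3)] cos_inj_pi by metis
  then have "pi / (2 * L) * (x - y) = 0" by (simp only: right_diff_distrib)
  then show ?thesis using assms(1) by simp
qed

lemma cosine_sum_mult_quarter_cos_sq:
  assumes "cosine_sum L h"
  shows "cosine_sum L (\<lambda>x. (quarter_cos L x)\<^sup>2 * h x)"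
  using assms
proof induction
  case (mode n)
  then show ?case unfolding quarter_cos_sq_mult_cos_mode by (intro cosine_sum.intros)
next
  case (scale h c)
  then show ?case using cosine_sum.scale[OF scale.IH, of c] by (simp add: algebra_simps)
next
  case (add h k)
  then show ?case using cosine_sum.add[OF add.IH] by (simp add: algebra_simps)
qed

text \<open>
Stone-Weierstrass, applied to the algebra of continuous multipliers that preserve the span of the modes. It
contains the constants and \<open>cos\<^sup>2 (\<pi> x / (2 L))\<close>, which is injective on \<open>[0, L]\<close> and hence separates
points. A multiplier takes mode \<open>0\<close> back into the span.
\<close>

lemma uniform_approximation_by_cosine_sums:
  assumes L: "L > 0" and G: "continuous_on {0..L} G" and e: "\<epsilon> > 0"
  shows "\<exists>q. cosine_sum L (\<lambda>x. q x * cos_mode L 0 x) \<and> (\<forall>x\<in>{0..L}. \<bar>G x - q x\<bar> < \<epsilon>)"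
proof -
  let ?P = "\<lambda>q. continuous_on {0..L} q \<and> (\<forall>h. cosine_sum L h \<longrightarrow> cosine_sum L (\<lambda>x. q x * h x))"
  have "\<exists>q. ?P q \<and> (\<forall>x\<in>{0..L}. \<bar>G x - q x\<bar> < \<epsilon>)"
  proof (rule Stone_Weierstrass_HOL)
    show "compact {0..L}" by simp
    show "continuous_on {0..L} G" by (rule G)
    show "0 < \<epsilon>" by (rule e)
    show "?P (\<lambda>x. c)" for c
      by (auto intro: cosine_sum.scale)
    show "continuous_on {0..L} f" if "?P f" for f using that by blast
    show "?P (\<lambda>x. f x + g x)" if "?P f \<and> ?P g" for f g
      using that by (auto intro!: continuous_intros cosine_sum.add simp: distrib_right)
    show "?P (\<lambda>x. f x * g x)" if "?P f \<and> ?P g" for f g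
      using that by (auto intro!: continuous_intros simp: mult.assoc)
    show "\<exists>f. ?P f \<and> f x \<noteq> f y" if "x \<in> {0..L} \<and> y \<in> {0..L} \<and> x \<noteq> y" for x y
    proof (intro exI conjI)
      show "continuous_on {0..L} (\<lambda>x. (quarter_cos L x)\<^sup>2)"
        unfolding quarter_cos_def by (intro continuous_intros)
      show "\<forall>h. cosine_sum L h \<longrightarrow> cosine_sum L (\<lambda>x. (quarter_cos L x)\<^sup>2 * h x)"
        using cosine_sum_mult_quarter_cos_sq by blast
      show "(quarter_cos L x)\<^sup>2 \<noteq> (quarter_cos L y)\<^sup>2"
        using that quarter_cos_sq_inj[OF L] by blast
    qed
  qed
  then show ?thesis using cosine_sum.mode by blast
qed

section \<open>Completeness and the Parseval identity\<close>

definition clamp_abs :: "real \<Rightarrow> real \<Rightarrow> real" where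
  "clamp_abs M y = max (-M) (min M y)"

lemma continuous_on_clamp_abs: "continuous_on S (clamp_abs M)"
  unfolding clamp_abs_def by (intro continuous_intros)

lemma AE_on_interval_not_in_negligible:
  assumes "negligible N"
  shows "AE x in lebesgue_on {0..L::real}. x \<notin> N"
proof -
  have "N \<in> null_sets lebesgue" using assms by (simp add: negligible_iff_null_sets)
  then have "AE x in lebesgue. x \<notin> N" by (rule AE_not_in)
  then have "AE x in lebesgue. x \<in> {0..L} \<longrightarrow> x \<notin> N" by eventually_elim blast
  then show ?thesis by (simp add: AE_restrict_space_iff)
qed

lemma tendsto_inner_L2_self_dominated:
  assumes meas: "\<And>n::nat. f n \<in> borel_measurable (lebesgue_on {0..L})"
    and w: "L2_on L w"
    and lim: "AE x in lebesgue_on {0..L}. (\<lambda>n. f n x) \<longlonglongrightarrow> 0"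
    and bound: "\<And>n x. x \<in> {0..L} \<Longrightarrow> \<bar>f n x\<bar> \<le> \<bar>w x\<bar>"
  shows "(\<lambda>n. inner_L2 L (f n) (f n)) \<longlonglongrightarrow> 0"
proof -
  have "(\<lambda>n. LINT x|lebesgue_on {0..L}. (f n x)\<^sup>2) \<longlonglongrightarrow> (LINT x|lebesgue_on {0..L}. 0)"
  proof (rule integral_dominated_convergence[where w = "\<lambda>x. (w x)\<^sup>2"])
    show "integrable (lebesgue_on {0..L}) (\<lambda>x. (w x)\<^sup>2)" using w by (simp add: L2_on_def)
    show "(\<lambda>x. (f n x)\<^sup>2) \<in> borel_measurable (lebesgue_on {0..L})" for n
      using meas by (rule borel_measurable_power)
    show "AE x in lebesgue_on {0..L}. (\<lambda>n. (f n x)\<^sup>2) \<longlonglongrightarrow> 0"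
      using lim
    proof eventually_elim
      case (elim x)
      then show ?case using tendsto_power[OF elim, of 2] by simp
    qed
    show "AE x in lebesgue_on {0..L}. norm ((f n x)\<^sup>2) \<le> (w x)\<^sup>2" for n
      using bound by (intro AE_I2) (simp add: abs_le_square_iff)
  qed simp
  then show ?thesis by (simp add: inner_L2_self)
qed

text \<open>
Divide \<open>f\<close> by mode \<open>0\<close>, approximate the quotient by a multiplier \<open>q\<close> as in the previous lemma, and multiply
back. The quotient \<open>h\<close> is only measurable, and unbounded near \<open>L\<close>, so two dominated limits come before the
uniform approximation: truncation of \<open>h\<close> at height \<open>M\<close>, and the replacement of \<open>h\<close> by continuous functions that
converge to it almost everywhere, truncated at the same height so that they stay dominated.
\<close>

lemma cosine_sums_dense:
  assumes L: "L > 0" and f: "L2_on L f" and e: "\<epsilon> > 0"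
  shows "\<exists>q. cosine_sum L q \<and> inner_L2 L (\<lambda>x. f x - q x) (\<lambda>x. f x - q x) < \<epsilon>"
proof -
  let ?e = "cos_mode L 0"
  let ?h = "\<lambda>x. f x / ?e x"
  have e_meas: "?e \<in> borel_measurable (lebesgue_on {0..L})"
    using L2_on_cos_mode by (rule L2_on_measurable)
  have f_meas: "f \<in> borel_measurable (lebesgue_on {0..L})" using f by (rule L2_on_measurable)
  have h_meas: "?h \<in> borel_measurable (lebesgue_on {0..L})"
    using f_meas e_meas by (rule borel_measurable_divide)
  have clamp_meas: "clamp_abs M \<in> borel_measurable borel" for M
    by (intro borel_measurable_continuous_onI continuous_on_clamp_abs)
  have e_pos: "?e x > 0" if "x \<in> {0..L}" "x \<noteq> L" for x
  proof -
    have "?e x = sqrt (2 / L) * quarter_cos L x"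
      by (simp add: cos_mode_def freq_def quarter_cos_def)
    then show ?thesis using quarter_cos_bounds[OF L, of x] that L by simp
  qed
  have inI: "AE x in lebesgue_on {0..L}. x \<in> {0..L}" by (rule AE_I2) simp

  let ?F = "\<lambda>M x. clamp_abs (real M) (?h x) * ?e x"
  have F_meas: "?F M \<in> borel_measurable (lebesgue_on {0..L})" for M
    using measurable_compose[OF h_meas clamp_meas] e_meas by (rule borel_measurable_times)
  have "(\<lambda>M. inner_L2 L (\<lambda>x. f x - ?F M x) (\<lambda>x. f x - ?F M x)) \<longlonglongrightarrow> 0"
  proof (rule tendsto_inner_L2_self_dominated[OF _ f])
    show "(\<lambda>x. f x - ?F M x) \<in> borel_measurable (lebesgue_on {0..L})" for M
      using f_meas F_meas by (rule borel_measurable_diff)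
    show "AE x in lebesgue_on {0..L}. (\<lambda>M. f x - ?F M x) \<longlonglongrightarrow> 0"
      using AE_on_interval_not_in_negligible[OF negligible_sing, of L L] inI
    proof eventually_elim
      case (elim x)
      obtain m where m: "\<bar>?h x\<bar> \<le> real m" using real_arch_simple by blast
      have "f x - ?F M x = 0" if "M \<ge> m" for M
      proof -
        have "\<bar>?h x\<bar> \<le> real M" using m that by (meson of_nat_le_iff order_trans)
        then have "clamp_abs (real M) (?h x) = ?h x" unfolding clamp_abs_def by linarith
        then show ?thesis using e_pos[OF elim(2)] elim(1) by simp
      qed
      then show ?case by (intro tendsto_eventually eventually_sequentiallyI)
    qed
    show "\<bar>f x - ?F M x\<bar> \<le> \<bar>f x\<bar>" if x: "x \<in> {0..L}" for M x
    proof (cases "x = L")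
      case True
      \<comment> \<open>The mode vanishes at the right end point, so the truncated product is \<open>0\<close> there whatever the quotient is.\<close>
      have "?e x = 0" using L True by (simp add: cos_mode_def freq_def)
      then show ?thesis by simp
    next
      case False
      have "f x - ?F M x = (?h x - clamp_abs (real M) (?h x)) * ?e x"
        using e_pos[OF x False] by (simp add: left_diff_distrib)
      moreover have "\<bar>?h x - clamp_abs (real M) (?h x)\<bar> \<le> \<bar>?h x\<bar>"
        unfolding clamp_abs_def by linarith
      ultimately have "\<bar>f x - ?F M x\<bar> \<le> \<bar>?h x\<bar> * \<bar>?e x\<bar>"
        by (metis abs_mult mult_right_mono abs_ge_zero)
      also have "\<dots> = \<bar>f x\<bar>" using e_pos[OF x False] by simp
      finally show ?thesis .
    qed
  qed
  \<comment> \<open>The truncation error counts twice in the final estimate, the other two errors count four times; hence \<open>\<epsilon> / 8\<close> here and \<open>\<epsilon> / 16\<close> below.\<close>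
  then have "\<forall>\<^sub>F M in sequentially. inner_L2 L (\<lambda>x. f x - ?F M x) (\<lambda>x. f x - ?F M x) < \<epsilon> / 8"
    by (rule order_tendstoD(2)) (use e in simp)
  then obtain M where M: "inner_L2 L (\<lambda>x. f x - ?F M x) (\<lambda>x. f x - ?F M x) < \<epsilon> / 8"
    unfolding eventually_sequentially by blast

  obtain N g where N: "negligible N" and g: "\<And>n::nat. continuous_on UNIV (g n)"
    and g_lim: "\<And>x. x \<notin> N \<Longrightarrow> (\<lambda>n. g n x) \<longlonglongrightarrow> (if x \<in> {0..L} then ?h x else 0)"
    using h_meas measurable_on_iff_borel_measurable[of "{0..L}" ?h]
    unfolding measurable_on_def by auto
  let ?G = "\<lambda>n x. clamp_abs (real M) (g n x)"
  have G: "continuous_on {0..L} (?G n)" for n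
    using continuous_on_compose2[OF continuous_on_clamp_abs g] continuous_on_subset by blast
  have Ge: "L2_on L (\<lambda>x. ?G n x * ?e x)" for n
    by (intro L2_on_continuous continuous_on_mult G continuous_on_cos_mode)
  have "(\<lambda>n. inner_L2 L (\<lambda>x. ?F M x - ?G n x * ?e x) (\<lambda>x. ?F M x - ?G n x * ?e x)) \<longlonglongrightarrow> 0"
  proof (rule tendsto_inner_L2_self_dominated[where w = "\<lambda>x. 2 * real M * ?e x"])
    show "L2_on L (\<lambda>x. 2 * real M * ?e x)" by (intro L2_on_cmult) simp
    show "(\<lambda>x. ?F M x - ?G n x * ?e x) \<in> borel_measurable (lebesgue_on {0..L})" for n
      using F_meas L2_on_measurable[OF Ge] by (rule borel_measurable_diff)
    show "AE x in lebesgue_on {0..L}. (\<lambda>n. ?F M x - ?G n x * ?e x) \<longlonglongrightarrow> 0"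
      using AE_on_interval_not_in_negligible[OF N] inI
    proof eventually_elim
      case (elim x)
      then have "(\<lambda>n. g n x) \<longlonglongrightarrow> ?h x" using g_lim[OF elim(1)] by simp
      then have "(\<lambda>n. ?G n x) \<longlonglongrightarrow> clamp_abs (real M) (?h x)"
        unfolding clamp_abs_def by (intro tendsto_intros)
      then have "(\<lambda>n. ?F M x - ?G n x * ?e x) \<longlonglongrightarrow> ?F M x - ?F M x"
        by (intro tendsto_intros)
      then show ?case by simp
    qed
    show "\<bar>?F M x - ?G n x * ?e x\<bar> \<le> \<bar>2 * real M * ?e x\<bar>" for n x
    proof -
      have "\<bar>clamp_abs (real M) a - clamp_abs (real M) b\<bar> \<le> 2 * real M" for a b
        unfolding clamp_abs_def by linarith
      then have "\<bar>clamp_abs (real M) (?h x) - ?G n x\<bar> * \<bar>?e x\<bar> \<le> 2 * real M * \<bar>?e x\<bar>"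
        by (intro mult_right_mono) auto
      then show ?thesis by (simp add: abs_mult flip: left_diff_distrib)
    qed
  qed
  then have "\<forall>\<^sub>F n in sequentially. inner_L2 L (\<lambda>x. ?F M x - ?G n x * ?e x) (\<lambda>x. ?F M x - ?G n x * ?e x) < \<epsilon> / 16"
    by (rule order_tendstoD(2)) (use e in simp)
  then obtain n where n: "inner_L2 L (\<lambda>x. ?F M x - ?G n x * ?e x) (\<lambda>x. ?F M x - ?G n x * ?e x) < \<epsilon> / 16"
    unfolding eventually_sequentially by blast

  \<comment> \<open>Mode \<open>0\<close> has norm \<open>1\<close>, so a uniform error \<open>\<delta>\<close> of the multiplier costs at most \<open>\<delta>\<^sup>2\<close>.\<close>
  define \<delta> where "\<delta> = sqrt (\<epsilon> / 16)"
  have d: "\<delta> > 0" using e by (simp add: \<delta>_def)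
  obtain q where q: "cosine_sum L (\<lambda>x. q x * ?e x)"
    and close: "\<And>x. x \<in> {0..L} \<Longrightarrow> \<bar>?G n x - q x\<bar> < \<delta>"
    using uniform_approximation_by_cosine_sums[OF L G d] by blast
  have q2: "L2_on L (\<lambda>x. q x * ?e x)" using cosine_sum_remainder[OF L q] by blast
  let ?D = "\<lambda>x. ?G n x * ?e x - q x * ?e x"
  have D: "L2_on L ?D" using Ge q2 by (rule L2_on_diff)
  have "inner_L2 L ?D ?D \<le> inner_L2 L (\<lambda>x. \<delta> * ?e x) (\<lambda>x. \<delta> * ?e x)"
    unfolding inner_L2_self
  proof (rule integral_mono)
    fix x assume "x \<in> space (lebesgue_on {0..L})"
    then have "\<bar>?G n x - q x\<bar> * \<bar>?e x\<bar> \<le> \<delta> * \<bar>?e x\<bar>"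
      using close[of x] by (intro mult_right_mono) auto
    then have "\<bar>?D x\<bar> \<le> \<bar>\<delta> * ?e x\<bar>"
      using d by (simp add: abs_mult flip: left_diff_distrib)
    then show "(?D x)\<^sup>2 \<le> (\<delta> * ?e x)\<^sup>2" by (simp only: abs_le_square_iff)
  next
    show "integrable (lebesgue_on {0..L}) (\<lambda>x. (?D x)\<^sup>2)" using D by (simp add: L2_on_def)
    have "L2_on L (\<lambda>x. \<delta> * ?e x)" by (intro L2_on_cmult) simp
    then show "integrable (lebesgue_on {0..L}) (\<lambda>x. (\<delta> * ?e x)\<^sup>2)" by (simp add: L2_on_def)
  qed
  also have "\<dots> = \<epsilon> / 16"
    using cos_mode_orthonormal[OF L, of 0 0] e
    by (simp add: inner_L2_cmult_left inner_L2_cmult_right \<delta>_def)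
  finally have Dle: "inner_L2 L ?D ?D \<le> \<epsilon> / 16" .

  let ?A = "\<lambda>x. f x - ?F M x" and ?B = "\<lambda>x. ?F M x - ?G n x * ?e x"
  have F: "L2_on L (?F M)"
    unfolding L2_on_def
  proof (intro conjI F_meas)
    show "integrable (lebesgue_on {0..L}) (\<lambda>x. (?F M x)\<^sup>2)"
    proof (rule Bochner_Integration.integrable_bound)
      have "L2_on L (\<lambda>x. real M * ?e x)" by (intro L2_on_cmult) simp
      then show "integrable (lebesgue_on {0..L}) (\<lambda>x. (real M * ?e x)\<^sup>2)" by (simp add: L2_on_def)
      show "(\<lambda>x. (?F M x)\<^sup>2) \<in> borel_measurable (lebesgue_on {0..L})"
        using F_meas by (rule borel_measurable_power)
      have "\<bar>clamp_abs (real M) y\<bar> \<le> real M" for y unfolding clamp_abs_def by linarith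
      then have "\<bar>?F M x\<bar> \<le> \<bar>real M * ?e x\<bar>" for x
        by (simp add: abs_mult mult_right_mono)
      then have "(?F M x)\<^sup>2 \<le> (real M * ?e x)\<^sup>2" for x by (simp only: abs_le_square_iff)
      then show "AE x in lebesgue_on {0..L}. norm ((?F M x)\<^sup>2) \<le> norm ((real M * ?e x)\<^sup>2)"
        by (intro AE_I2) simp
    qed
  qed
  have A: "L2_on L ?A" and B: "L2_on L ?B"
    by (rule L2_on_diff[OF f F], rule L2_on_diff[OF F Ge])
  have "inner_L2 L (\<lambda>x. ?A x + (?B x + ?D x)) (\<lambda>x. ?A x + (?B x + ?D x))
      \<le> 2 * inner_L2 L ?A ?A + 4 * inner_L2 L ?B ?B + 4 * inner_L2 L ?D ?D"
    by (rule inner_L2_self_add3_le[OF A B D])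
  also have "\<dots> < \<epsilon>"
  proof -
    have "2 * a + 4 * b + 4 * d < \<epsilon>" if "a < \<epsilon> / 8" "b < \<epsilon> / 16" "d \<le> \<epsilon> / 16" for a b d :: real
      using that e by linarith
    from this[OF M n Dle] show ?thesis .
  qed
  finally show ?thesis using q by auto
qed

theorem cos_mode_Parseval:
  assumes L: "L > 0" and f: "L2_on L f"
  shows "(\<lambda>n. (inner_L2 L f (cos_mode L n))\<^sup>2) sums inner_L2 L f f"
proof (rule Parseval_from_approximation[OF L f])
  fix \<epsilon> :: real assume "\<epsilon> > 0"
  then show "\<exists>q N. L2_on L q \<and> (\<forall>M\<ge>N. fourier_remainder L M q = (\<lambda>x. 0)) \<and>
      inner_L2 L (\<lambda>x. f x - q x) (\<lambda>x. f x - q x) < \<epsilon>"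
    using cosine_sums_dense[OF L f] cosine_sum_remainder[OF L] by metis
qed

corollary cos_mode_coefficients_determine:
  assumes L: "L > 0" and f: "L2_on L f" and g: "L2_on L g"
    and eq: "\<And>n. inner_L2 L f (cos_mode L n) = inner_L2 L g (cos_mode L n)"
  shows "AE x in lebesgue_on {0..L}. f x = g x"
proof -
  have d: "L2_on L (\<lambda>x. f x - g x)" using f g by (rule L2_on_diff)
  have "(\<lambda>n. 0::real) sums inner_L2 L (\<lambda>x. f x - g x) (\<lambda>x. f x - g x)"
    using cos_mode_Parseval[OF L d] f g eq by (simp add: inner_L2_diff_left)
  then have "inner_L2 L (\<lambda>x. f x - g x) (\<lambda>x. f x - g x) = 0"
    using sums_unique2 sums_zero by metis
  from inner_L2_self_eq_0_AE[OF d this] show ?thesis by simp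
qed

section \<open>Weak solutions as continuous trajectories\<close>

text \<open>
The part of \<open>continuous_state\<close> that concerns the distributed component.
\<close>

definition L2_trajectory :: "real \<Rightarrow> (real \<Rightarrow> real \<Rightarrow> real) \<Rightarrow> bool" where
  "L2_trajectory L u \<longleftrightarrow> (\<forall>t\<ge>0. L2_on L (u t)) \<and>
     (\<forall>t\<ge>0. ((\<lambda>s. inner_L2 L (\<lambda>x. u s x - u t x) (\<lambda>x. u s x - u t x)) \<longlongrightarrow> 0) (at t within {0..}))"

lemma continuous_state_iff:
  "continuous_state L \<theta> u \<longleftrightarrow> continuous_on {0..} \<theta> \<and> L2_trajectory L u"
  by (simp add: continuous_state_def L2_trajectory_def inner_L2_self)

lemma L2_trajectory_L2_on: "L2_trajectory L u \<Longrightarrow> 0 \<le> t \<Longrightarrow> L2_on L (u t)"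
  by (simp add: L2_trajectory_def)

lemma continuous_on_slice:
  assumes "continuous_on ({0..} \<times> {0..L}) (\<lambda>(t, x). \<psi> t x)" "0 \<le> (t::real)"
  shows "continuous_on {0..L} (\<psi> t)"
  using continuous_on_compose2[OF assms(1), of "{0..L}" "\<lambda>x. (t, x)"] assms(2)
  by (simp add: continuous_on_Pair image_subset_iff)

lemma continuous_on_inner_L2:
  assumes "continuous_on ({0..} \<times> {0..L}) (\<lambda>(t, x). \<psi> t x)"
    "continuous_on ({0..} \<times> {0..L}) (\<lambda>(t, x). \<rho> t x)"
  shows "continuous_on {0..} (\<lambda>t::real. inner_L2 L (\<psi> t) (\<rho> t))"
proof -
  have "continuous_on ({0..} \<times> {0..L}) (\<lambda>(t, x). \<psi> t x * \<rho> t x)"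
    using continuous_on_mult[OF assms] by (simp add: case_prod_unfold)
  then have "continuous_on {0..} (\<lambda>t. integral (cbox 0 L) (\<lambda>x. \<psi> t x * \<rho> t x))"
    by (intro integral_continuous_on_param) simp
  moreover have "integral (cbox 0 L) (\<lambda>x. \<psi> t x * \<rho> t x) = inner_L2 L (\<psi> t) (\<rho> t)"
    if "t \<in> {0..}" for t
    using that assms by (simp add: inner_L2_continuous continuous_on_slice)
  ultimately show ?thesis by (blast intro: continuous_on_eq)
qed

lemma L2_trajectory_continuous:
  assumes "continuous_on ({0..} \<times> {0..L}) (\<lambda>(t, x). u t x)"
  shows "L2_trajectory L u"
  unfolding L2_trajectory_def
proof (intro conjI allI impI)
  fix t :: real assume t: "0 \<le> t"
  show "L2_on L (u t)" using continuous_on_slice[OF assms t] by (rule L2_on_continuous)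
  have "continuous_on ({0..} \<times> {0..L}) (\<lambda>(s, x). u t x)"
    unfolding case_prod_unfold
    by (rule continuous_on_compose2[OF continuous_on_slice[OF assms t]])
      (auto intro!: continuous_intros)
  then have "continuous_on ({0..} \<times> {0..L}) (\<lambda>(s, x). u s x - u t x)"
    using continuous_on_diff[OF assms] by (simp add: case_prod_unfold)
  note continuous_on_inner_L2[OF this this]
  moreover have "t \<in> {0..}" using t by simp
  ultimately have "((\<lambda>s. inner_L2 L (\<lambda>x. u s x - u t x) (\<lambda>x. u s x - u t x))
      \<longlongrightarrow> inner_L2 L (\<lambda>x. u t x - u t x) (\<lambda>x. u t x - u t x)) (at t within {0..})"
    unfolding continuous_on_def by (rule bspec)
  then show "((\<lambda>s. inner_L2 L (\<lambda>x. u s x - u t x) (\<lambda>x. u s x - u t x)) \<longlongrightarrow> 0) (at t within {0..})"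
    by (simp add: inner_L2_def)
qed

lemma L2_trajectory_cmult:
  assumes "L2_trajectory L u"
  shows "L2_trajectory L (\<lambda>t x. c * u t x)"
  unfolding L2_trajectory_def
proof (intro conjI allI impI)
  fix t :: real assume t: "0 \<le> t"
  show "L2_on L (\<lambda>x. c * u t x)" using L2_trajectory_L2_on[OF assms t] by (rule L2_on_cmult)
  have "((\<lambda>s. c * (c * inner_L2 L (\<lambda>x. u s x - u t x) (\<lambda>x. u s x - u t x))) \<longlongrightarrow> c * (c * 0))
      (at t within {0..})"
    using assms t unfolding L2_trajectory_def by (intro tendsto_intros) auto
  then show "((\<lambda>s. inner_L2 L (\<lambda>x. c * u s x - c * u t x) (\<lambda>x. c * u s x - c * u t x)) \<longlongrightarrow> 0)
      (at t within {0..})"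
    by (simp only: flip: right_diff_distrib) (simp add: inner_L2_cmult_left inner_L2_cmult_right)
qed

lemma L2_trajectory_add:
  assumes u: "L2_trajectory L u" and v: "L2_trajectory L v"
  shows "L2_trajectory L (\<lambda>t x. u t x + v t x)"
  unfolding L2_trajectory_def
proof (intro conjI allI impI)
  fix t :: real assume t: "0 \<le> t"
  show "L2_on L (\<lambda>x. u t x + v t x)"
    using L2_trajectory_L2_on[OF u t] L2_trajectory_L2_on[OF v t] by (rule L2_on_add)
  let ?d = "\<lambda>w s. inner_L2 L (\<lambda>x. w s x - w t x) (\<lambda>x. w s x - w t x)"
  have "((\<lambda>s. 2 * ?d u s + 2 * ?d v s) \<longlongrightarrow> 2 * 0 + 2 * 0) (at t within {0..})"
    using u v t unfolding L2_trajectory_def by (intro tendsto_intros) auto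
  then have lim: "((\<lambda>s. 2 * ?d u s + 2 * ?d v s) \<longlongrightarrow> 0) (at t within {0..})" by simp
  have "\<forall>\<^sub>F s in at t within {0..}. norm (?d (\<lambda>t x. u t x + v t x) s) \<le> 2 * ?d u s + 2 * ?d v s"
    unfolding eventually_at_filter
  proof (intro always_eventually allI impI)
    fix s :: real assume s: "s \<in> {0..}"
    have "inner_L2 L (\<lambda>x. (u s x - u t x) + (v s x - v t x)) (\<lambda>x. (u s x - u t x) + (v s x - v t x))
        \<le> 2 * ?d u s + 2 * ?d v s"
      using s t by (intro inner_L2_self_add_le L2_on_diff L2_trajectory_L2_on u v) auto
    moreover have "(\<lambda>x. (u s x - u t x) + (v s x - v t x)) = (\<lambda>x. (u s x + v s x) - (u t x + v t x))"
      by (auto simp: fun_eq_iff)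
    ultimately show "norm (?d (\<lambda>t x. u t x + v t x) s) \<le> 2 * ?d u s + 2 * ?d v s"
      using inner_L2_self_nonneg by simp
  qed
  then show "(?d (\<lambda>t x. u t x + v t x) \<longlongrightarrow> 0) (at t within {0..})"
    using lim by (rule Lim_null_comparison)
qed

text \<open>
All time integrands of the weak formulation are of this form. Their continuity provides the
integrability that linear combinations and limits of weak solutions require.
\<close>

lemma L2_trajectory_pairing_continuous:
  assumes u: "L2_trajectory L u"
    and psi: "continuous_on ({0..} \<times> {0..L}) (\<lambda>(t, x). \<psi> t x)"
  shows "continuous_on {0..} (\<lambda>t. inner_L2 L (u t) (\<psi> t))"
  unfolding continuous_on_def
proof
  fix t :: real assume "t \<in> {0..}"
  then have t: "0 \<le> t" by simp
  let ?du = "\<lambda>s. inner_L2 L (\<lambda>x. u s x - u t x) (\<lambda>x. u s x - u t x)"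
  let ?dp = "\<lambda>s. inner_L2 L (\<lambda>x. \<psi> s x - \<psi> t x) (\<lambda>x. \<psi> s x - \<psi> t x)"
  let ?bound = "\<lambda>s. sqrt (?du s) * sqrt (inner_L2 L (\<psi> s) (\<psi> s))
      + sqrt (inner_L2 L (u t) (u t)) * sqrt (?dp s)"
  have p: "L2_on L (\<psi> s)" if "0 \<le> s" for s
    using continuous_on_slice[OF psi that] by (rule L2_on_continuous)
  have "(?bound \<longlongrightarrow> sqrt 0 * sqrt (inner_L2 L (\<psi> t) (\<psi> t)) + sqrt (inner_L2 L (u t) (u t)) * sqrt 0)
      (at t within {0..})"
  proof (intro tendsto_intros)
    show "(?du \<longlongrightarrow> 0) (at t within {0..})" "(?dp \<longlongrightarrow> 0) (at t within {0..})"
      using u L2_trajectory_continuous[OF psi] t by (auto simp: L2_trajectory_def)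
    show "((\<lambda>s. inner_L2 L (\<psi> s) (\<psi> s)) \<longlongrightarrow> inner_L2 L (\<psi> t) (\<psi> t)) (at t within {0..})"
      using continuous_on_inner_L2[OF psi psi] t by (simp add: continuous_on_def)
  qed
  then have lim: "(?bound \<longlongrightarrow> 0) (at t within {0..})" by simp
  have "\<forall>\<^sub>F s in at t within {0..}.
      norm (inner_L2 L (u s) (\<psi> s) - inner_L2 L (u t) (\<psi> t)) \<le> ?bound s"
    unfolding eventually_at_filter
  proof (intro always_eventually allI impI)
    fix s :: real assume "s \<in> {0..}"
    then have s: "0 \<le> s" by simp
    note L2 = L2_trajectory_L2_on[OF u s] L2_trajectory_L2_on[OF u t] p[OF s] p[OF t]
    have "inner_L2 L (u s) (\<psi> s) - inner_L2 L (u t) (\<psi> t)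
        = inner_L2 L (\<lambda>x. u s x - u t x) (\<psi> s) + inner_L2 L (u t) (\<lambda>x. \<psi> s x - \<psi> t x)"
      using L2 by (simp add: inner_L2_diff_left inner_L2_diff_right)
    moreover have "\<bar>inner_L2 L (\<lambda>x. u s x - u t x) (\<psi> s)\<bar>
        \<le> sqrt (?du s) * sqrt (inner_L2 L (\<psi> s) (\<psi> s))"
      by (intro abs_inner_L2_le L2_on_diff L2)
    moreover have "\<bar>inner_L2 L (u t) (\<lambda>x. \<psi> s x - \<psi> t x)\<bar>
        \<le> sqrt (inner_L2 L (u t) (u t)) * sqrt (?dp s)"
      by (intro abs_inner_L2_le L2_on_diff L2)
    ultimately show "norm (inner_L2 L (u s) (\<psi> s) - inner_L2 L (u t) (\<psi> t)) \<le> ?bound s"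
      by simp
  qed
  then have "((\<lambda>s. inner_L2 L (u s) (\<psi> s) - inner_L2 L (u t) (\<psi> t)) \<longlongrightarrow> 0) (at t within {0..})"
    using lim by (rule Lim_null_comparison)
  then show "((\<lambda>s. inner_L2 L (u s) (\<psi> s)) \<longlongrightarrow> inner_L2 L (u t) (\<psi> t)) (at t within {0..})"
    by (rule LIM_zero_cancel)
qed

lemma LINT_interval_continuous:
  assumes "continuous_on {0..} (f :: real \<Rightarrow> real)"
  shows "integrable (lebesgue_on {0..T}) f" "(LINT t|lebesgue_on {0..T}. f t) = integral {0..T} f"
proof -
  show i: "integrable (lebesgue_on {0..T}) f"
    by (rule continuous_imp_integrable_real) (use assms continuous_on_subset in force)
  show "(LINT t|lebesgue_on {0..T}. f t) = integral {0..T} f"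
    using i by (rule lebesgue_integral_eq_integral) simp
qed

text \<open>
Continuity of the input and of the state is included because the Lebesgue integral of a non-integrable
function is \<open>0\<close> by convention: weak identities can be added only if the time integrands are integrable.
\<close>

definition heat_trajectory :: "real \<Rightarrow> (real \<Rightarrow> real) \<Rightarrow> (real \<Rightarrow> real \<Rightarrow> real) \<Rightarrow> bool" where
  "heat_trajectory L U u \<longleftrightarrow>
     continuous_on {0..} U \<and> L2_trajectory L u \<and> weak_heat_solution L U u"

text \<open>
The time integrand on the right-hand side of the weak formulation.
\<close>

definition heat_pairing where
  "heat_pairing L U u \<phi>x \<phi>xx \<phi>t t = inner_L2 L (u t) (\<lambda>x. \<phi>t t x + \<phi>xx t x) - U t * \<phi>x t L"

lemma weak_heat_solution_iff:
  "weak_heat_solution L U u \<longleftrightarrow> (\<forall>\<phi> \<phi>x \<phi>xx \<phi>t. test_function L \<phi> \<phi>x \<phi>xx \<phi>t \<longrightarrow> (\<forall>T\<ge>0.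
     inner_L2 L (u T) (\<phi> T) - inner_L2 L (u 0) (\<phi> 0)
       = (LINT t|lebesgue_on {0..T}. heat_pairing L U u \<phi>x \<phi>xx \<phi>t t)))"
  by (simp only: weak_heat_solution_def inner_L2_def heat_pairing_def)

lemma test_function_source_continuous:
  assumes "test_function L \<phi> \<phi>x \<phi>xx \<phi>t"
  shows "continuous_on ({0..} \<times> {0..L}) (\<lambda>(t, x). \<phi>t t x + \<phi>xx t x)"
proof -
  have "continuous_on ({0..} \<times> {0..L}) (\<lambda>(t, x). \<phi>t t x)"
    "continuous_on ({0..} \<times> {0..L}) (\<lambda>(t, x). \<phi>xx t x)"
    using assms by (auto simp: test_function_def)
  from continuous_on_add[OF this] show ?thesis by (simp add: case_prod_unfold)
qed

lemma test_function_L2_on: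
  assumes "test_function L \<phi> \<phi>x \<phi>xx \<phi>t" "0 \<le> t"
  shows "L2_on L (\<phi> t)" "L2_on L (\<lambda>x. \<phi>t t x + \<phi>xx t x)"
proof -
  have "continuous_on ({0..} \<times> {0..L}) (\<lambda>(t, x). \<phi> t x)"
    using assms by (auto simp: test_function_def)
  from continuous_on_slice[OF this assms(2)] show "L2_on L (\<phi> t)" by (rule L2_on_continuous)
  from continuous_on_slice[OF test_function_source_continuous[OF assms(1)] assms(2)]
  show "L2_on L (\<lambda>x. \<phi>t t x + \<phi>xx t x)" by (rule L2_on_continuous)
qed

lemma heat_pairing_continuous:
  assumes L: "0 \<le> L" and U: "continuous_on {0..} U" and u: "L2_trajectory L u"
    and phi: "test_function L \<phi> \<phi>x \<phi>xx \<phi>t"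
  shows "continuous_on {0..} (heat_pairing L U u \<phi>x \<phi>xx \<phi>t)"
proof -
  have "continuous_on ({0..} \<times> {0..L}) (\<lambda>(t, x). \<phi>x t x)"
    using phi by (auto simp: test_function_def)
  from continuous_on_compose2[OF this, of "{0..}" "\<lambda>t. (t, L)"]
  have "continuous_on {0..} (\<lambda>t. \<phi>x t L)"
    using L by (simp add: continuous_on_Pair image_subset_iff)
  then have "continuous_on {0..} (\<lambda>t. U t * \<phi>x t L)"
    by (rule continuous_on_mult[OF U])
  with L2_trajectory_pairing_continuous[OF u test_function_source_continuous[OF phi]]
  show ?thesis unfolding heat_pairing_def by (rule continuous_on_diff)
qed

lemma heat_trajectory_cmult:
  assumes "heat_trajectory L U u"
  shows "heat_trajectory L (\<lambda>t. c * U t) (\<lambda>t x. c * u t x)"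
proof -
  have pairing: "heat_pairing L (\<lambda>t. c * U t) (\<lambda>t x. c * u t x) \<phi>x \<phi>xx \<phi>t
      = (\<lambda>t. c * heat_pairing L U u \<phi>x \<phi>xx \<phi>t t)" for \<phi>x \<phi>xx \<phi>t
    by (simp add: fun_eq_iff heat_pairing_def inner_L2_cmult_left right_diff_distrib)
  have "weak_heat_solution L U u" using assms by (simp add: heat_trajectory_def)
  then have "weak_heat_solution L (\<lambda>t. c * U t) (\<lambda>t x. c * u t x)"
    unfolding weak_heat_solution_iff pairing inner_L2_cmult_left
    by (simp flip: right_diff_distrib)
  moreover have "continuous_on {0..} (\<lambda>t. c * U t)"
    using assms by (intro continuous_on_mult continuous_on_const) (simp add: heat_trajectory_def)
  ultimately show ?thesis
    using assms by (simp add: heat_trajectory_def L2_trajectory_cmult)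
qed

lemma heat_trajectory_add:
  assumes L: "0 \<le> L" and u: "heat_trajectory L U u" and v: "heat_trajectory L V v"
  shows "heat_trajectory L (\<lambda>t. U t + V t) (\<lambda>t x. u t x + v t x)"
  unfolding heat_trajectory_def
proof (intro conjI)
  have U: "continuous_on {0..} U" and V: "continuous_on {0..} V"
    and ut: "L2_trajectory L u" and vt: "L2_trajectory L v"
    using u v by (auto simp: heat_trajectory_def)
  show "continuous_on {0..} (\<lambda>t. U t + V t)" using U V by (intro continuous_intros)
  show "L2_trajectory L (\<lambda>t x. u t x + v t x)" using ut vt by (rule L2_trajectory_add)
  show "weak_heat_solution L (\<lambda>t. U t + V t) (\<lambda>t x. u t x + v t x)"
    unfolding weak_heat_solution_iff
  proof (intro allI impI)
    fix \<phi> \<phi>x \<phi>xx \<phi>t and T :: real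
    assume phi: "test_function L \<phi> \<phi>x \<phi>xx \<phi>t" and T: "0 \<le> T"
    let ?P = "\<lambda>U u. heat_pairing L U u \<phi>x \<phi>xx \<phi>t"
    have "(LINT t|lebesgue_on {0..T}. ?P (\<lambda>t. U t + V t) (\<lambda>t x. u t x + v t x) t)
        = (LINT t|lebesgue_on {0..T}. ?P U u t + ?P V v t)"
    proof (rule Bochner_Integration.integral_cong[OF refl])
      fix t assume "t \<in> space (lebesgue_on {0..T})"
      then have t: "0 \<le> t" by simp
      show "?P (\<lambda>t. U t + V t) (\<lambda>t x. u t x + v t x) t = ?P U u t + ?P V v t"
        using L2_trajectory_L2_on[OF ut t] L2_trajectory_L2_on[OF vt t] test_function_L2_on[OF phi t]
        by (simp add: heat_pairing_def inner_L2_add_left algebra_simps)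
    qed
    also have "\<dots> = (LINT t|lebesgue_on {0..T}. ?P U u t) + (LINT t|lebesgue_on {0..T}. ?P V v t)"
      by (intro Bochner_Integration.integral_add LINT_interval_continuous(1)
          heat_pairing_continuous[OF L _ _ phi] U V ut vt)
    also have "\<dots> = (inner_L2 L (u T) (\<phi> T) - inner_L2 L (u 0) (\<phi> 0))
        + (inner_L2 L (v T) (\<phi> T) - inner_L2 L (v 0) (\<phi> 0))"
    proof -
      have "inner_L2 L (u T) (\<phi> T) - inner_L2 L (u 0) (\<phi> 0) = (LINT t|lebesgue_on {0..T}. ?P U u t)"
        "inner_L2 L (v T) (\<phi> T) - inner_L2 L (v 0) (\<phi> 0) = (LINT t|lebesgue_on {0..T}. ?P V v t)"
        using u v phi T unfolding heat_trajectory_def weak_heat_solution_iff by blast+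
      then show ?thesis by simp
    qed
    also have "\<dots> = inner_L2 L (\<lambda>x. u T x + v T x) (\<phi> T) - inner_L2 L (\<lambda>x. u 0 x + v 0 x) (\<phi> 0)"
      using L2_trajectory_L2_on[OF ut] L2_trajectory_L2_on[OF vt] test_function_L2_on(1)[OF phi] T
      by (simp add: inner_L2_add_left)
    finally show "inner_L2 L (\<lambda>x. u T x + v T x) (\<phi> T) - inner_L2 L (\<lambda>x. u 0 x + v 0 x) (\<phi> 0)
      = (LINT t|lebesgue_on {0..T}. ?P (\<lambda>t. U t + V t) (\<lambda>t x. u t x + v t x) t)" by simp
  qed
qed

text \<open>
Both sides of the weak identity are continuous with respect to convergence in \<open>L\<^sup>2\<close> that is uniform in time,
by the Cauchy-Schwarz inequality.
\<close>

lemma heat_trajectory_limit: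
  assumes L: "0 \<le> L"
    and uN: "\<And>N::nat. heat_trajectory L U (uN N)"
    and u: "L2_trajectory L u"
    and close: "\<And>N t. 0 \<le> t \<Longrightarrow>
      inner_L2 L (\<lambda>x. u t x - uN N t x) (\<lambda>x. u t x - uN N t x) \<le> \<delta> N"
    and lim: "\<delta> \<longlonglongrightarrow> 0"
  shows "heat_trajectory L U u"
  unfolding heat_trajectory_def
proof (intro conjI u)
  have U: "continuous_on {0..} U" and uNt: "\<And>N. L2_trajectory L (uN N)"
    using uN by (auto simp: heat_trajectory_def)
  show "continuous_on {0..} U" by (rule U)
  have sqlim: "(\<lambda>N. sqrt (\<delta> N)) \<longlonglongrightarrow> 0"
    using tendsto_real_sqrt[OF lim] by simp
  have pair: "\<bar>inner_L2 L (u t) \<psi> - inner_L2 L (uN N t) \<psi>\<bar> \<le> sqrt (\<delta> N) * sqrt (inner_L2 L \<psi> \<psi>)"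
    if "0 \<le> t" "L2_on L \<psi>" for t \<psi> N
  proof -
    have L2: "L2_on L (u t)" "L2_on L (uN N t)"
      using L2_trajectory_L2_on u uNt that by blast+
    have "\<bar>inner_L2 L (\<lambda>x. u t x - uN N t x) \<psi>\<bar>
        \<le> sqrt (inner_L2 L (\<lambda>x. u t x - uN N t x) (\<lambda>x. u t x - uN N t x)) * sqrt (inner_L2 L \<psi> \<psi>)"
      by (intro abs_inner_L2_le L2_on_diff L2 that)
    also have "\<dots> \<le> sqrt (\<delta> N) * sqrt (inner_L2 L \<psi> \<psi>)"
      using close[OF that(1)] by (intro mult_right_mono real_sqrt_le_mono) (simp_all add: inner_L2_self_nonneg)
    finally show ?thesis using L2 that by (simp add: inner_L2_diff_left)
  qed
  have pair_lim: "(\<lambda>N. inner_L2 L (uN N t) \<psi>) \<longlonglongrightarrow> inner_L2 L (u t) \<psi>"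
    if "0 \<le> t" "L2_on L \<psi>" for t \<psi>
  proof (rule LIM_zero_cancel, rule Lim_null_comparison)
    show "\<forall>\<^sub>F N in sequentially. norm (inner_L2 L (uN N t) \<psi> - inner_L2 L (u t) \<psi>)
        \<le> sqrt (\<delta> N) * sqrt (inner_L2 L \<psi> \<psi>)"
      using pair[OF that] by (simp add: abs_minus_commute)
    show "(\<lambda>N. sqrt (\<delta> N) * sqrt (inner_L2 L \<psi> \<psi>)) \<longlonglongrightarrow> 0"
      using tendsto_mult_left_zero[OF sqlim] by blast
  qed
  show "weak_heat_solution L U u"
    unfolding weak_heat_solution_iff
  proof (intro allI impI)
    fix \<phi> \<phi>x \<phi>xx \<phi>t and T :: real
    assume phi: "test_function L \<phi> \<phi>x \<phi>xx \<phi>t" and T: "0 \<le> T"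
    let ?P = "\<lambda>u t. heat_pairing L U u \<phi>x \<phi>xx \<phi>t t"
    let ?n = "\<lambda>t. sqrt (inner_L2 L (\<lambda>x. \<phi>t t x + \<phi>xx t x) (\<lambda>x. \<phi>t t x + \<phi>xx t x))"
    note source = test_function_source_continuous[OF phi]
    have n: "continuous_on {0..} ?n"
      by (intro continuous_intros continuous_on_inner_L2 source)
    have P: "continuous_on {0..} (?P u)" "continuous_on {0..} (?P (uN N))" for N
      by (intro heat_pairing_continuous[OF L U _ phi] u uNt)+
    have lim1: "(\<lambda>N. LINT t|lebesgue_on {0..T}. ?P (uN N) t) \<longlonglongrightarrow> (LINT t|lebesgue_on {0..T}. ?P u t)"
    proof (rule LIM_zero_cancel, rule Lim_null_comparison)
      show "\<forall>\<^sub>F N in sequentially.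
          norm ((LINT t|lebesgue_on {0..T}. ?P (uN N) t) - (LINT t|lebesgue_on {0..T}. ?P u t))
          \<le> sqrt (\<delta> N) * (LINT t|lebesgue_on {0..T}. ?n t)"
      proof (intro always_eventually allI)
        fix N
        have "norm ((LINT t|lebesgue_on {0..T}. ?P (uN N) t) - (LINT t|lebesgue_on {0..T}. ?P u t))
            = norm (LINT t|lebesgue_on {0..T}. ?P (uN N) t - ?P u t)"
          using P by (subst Bochner_Integration.integral_diff) (auto intro: LINT_interval_continuous)
        also have "\<dots> \<le> (LINT t|lebesgue_on {0..T}. norm (?P (uN N) t - ?P u t))"
          by (rule integral_norm_bound)
        also have "\<dots> \<le> (LINT t|lebesgue_on {0..T}. sqrt (\<delta> N) * ?n t)"
        proof (rule integral_mono)
          show "integrable (lebesgue_on {0..T}) (\<lambda>t. norm (?P (uN N) t - ?P u t))"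
            by (intro LINT_interval_continuous continuous_intros P)
          show "integrable (lebesgue_on {0..T}) (\<lambda>t. sqrt (\<delta> N) * ?n t)"
            by (intro LINT_interval_continuous continuous_on_mult continuous_on_const n)
          fix t assume "t \<in> space (lebesgue_on {0..T})"
          then have t: "0 \<le> t" by simp
          show "norm (?P (uN N) t - ?P u t) \<le> sqrt (\<delta> N) * ?n t"
            using pair[OF t test_function_L2_on(2)[OF phi t], of N]
            by (simp add: heat_pairing_def abs_minus_commute)
        qed
        finally show "norm ((LINT t|lebesgue_on {0..T}. ?P (uN N) t) - (LINT t|lebesgue_on {0..T}. ?P u t))
          \<le> sqrt (\<delta> N) * (LINT t|lebesgue_on {0..T}. ?n t)" by simp
      qed
      show "(\<lambda>N. sqrt (\<delta> N) * (LINT t|lebesgue_on {0..T}. ?n t)) \<longlonglongrightarrow> 0"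
        using tendsto_mult_left_zero[OF sqlim] by blast
    qed
    have eq: "(\<lambda>N. LINT t|lebesgue_on {0..T}. ?P (uN N) t)
        = (\<lambda>N. inner_L2 L (uN N T) (\<phi> T) - inner_L2 L (uN N 0) (\<phi> 0))"
      using uN phi T unfolding heat_trajectory_def weak_heat_solution_iff by metis
    have lim2: "(\<lambda>N. inner_L2 L (uN N T) (\<phi> T) - inner_L2 L (uN N 0) (\<phi> 0))
        \<longlonglongrightarrow> inner_L2 L (u T) (\<phi> T) - inner_L2 L (u 0) (\<phi> 0)"
      using T test_function_L2_on(1)[OF phi] by (intro tendsto_diff pair_lim) auto
    show "inner_L2 L (u T) (\<phi> T) - inner_L2 L (u 0) (\<phi> 0)
        = (LINT t|lebesgue_on {0..T}. ?P u t)"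
      by (rule LIMSEQ_unique[OF lim2 lim1[unfolded eq]])
  qed
qed

section \<open>Separated solutions and uniqueness\<close>

text \<open>
This one computation serves both for the eigenmodes, whose boundary value is \<open>0\<close>, and for the particular
solution that carries the exponential boundary input of the closed loop. The boundary term of the weak form
comes from integrating \<open>cos (\<mu> x) (\<phi>\<^sub>x\<^sub>x + \<mu>\<^sup>2 \<phi>)\<close>, which is the derivative of
\<open>cos (\<mu> x) \<phi>\<^sub>x + \<mu> sin (\<mu> x) \<phi>\<close>.
\<close>

lemma heat_trajectory_separated_mode:
  assumes L: "0 \<le> L"
  shows "heat_trajectory L (\<lambda>t. exp (- (\<mu>\<^sup>2 * t)) * cos (\<mu> * L)) (\<lambda>t x. exp (- (\<mu>\<^sup>2 * t)) * cos (\<mu> * x))"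
    (is "heat_trajectory L ?U ?u")
  unfolding heat_trajectory_def
proof (intro conjI)
  show U: "continuous_on {0..} ?U" by (intro continuous_intros)
  have u: "continuous_on ({0..} \<times> {0..L}) (\<lambda>(t, x). ?u t x)"
    unfolding case_prod_unfold by (intro continuous_intros)
  show traj: "L2_trajectory L ?u" using u by (rule L2_trajectory_continuous)
  show "weak_heat_solution L ?U ?u"
    unfolding weak_heat_solution_iff
  proof (intro allI impI)
    fix \<phi> \<phi>x \<phi>xx \<phi>t and T :: real
    assume test: "test_function L \<phi> \<phi>x \<phi>xx \<phi>t" and T: "0 \<le> T"
    then have dx: "((\<lambda>y. \<phi> t y) has_real_derivative \<phi>x t x) (at x within {0..L})"
      and dxx: "((\<lambda>y. \<phi>x t y) has_real_derivative \<phi>xx t x) (at x within {0..L})"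
      and dt: "((\<lambda>s. \<phi> s x) has_real_derivative \<phi>t t x) (at t within {0..})"
      if "t \<ge> 0" "x \<in> {0..L}" for t x
      using that by (auto simp: test_function_def)
    have phi: "continuous_on ({0..} \<times> {0..L}) (\<lambda>(t, x). \<phi> t x)"
      and phixx: "continuous_on ({0..} \<times> {0..L}) (\<lambda>(t, x). \<phi>xx t x)"
      and phit: "continuous_on ({0..} \<times> {0..L}) (\<lambda>(t, x). \<phi>t t x)"
      and bc: "\<And>t. t \<ge> 0 \<Longrightarrow> \<phi>x t 0 = 0 \<and> \<phi> t L = 0"
      using test by (auto simp: test_function_def)
    let ?P = "heat_pairing L ?U ?u \<phi>x \<phi>xx \<phi>t"
    let ?F = "\<lambda>t. integral (cbox 0 L) (\<lambda>x. ?u t x * \<phi> t x)"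
    let ?Ft = "\<lambda>t. integral (cbox 0 L) (\<lambda>x. ?u t x * (\<phi>t t x - \<mu>\<^sup>2 * \<phi> t x))"
    have prod_cont: "continuous_on ({0..} \<times> {0..L}) (\<lambda>(t, x). ?u t x * \<psi> t x)"
      if "continuous_on ({0..} \<times> {0..L}) (\<lambda>(t, x). \<psi> t x)" for \<psi>
      using continuous_on_mult[OF u that] by (simp add: case_prod_unfold)
    have int: "(\<lambda>x. ?u t x * \<psi> t x) integrable_on {0..L}"
      if "continuous_on ({0..} \<times> {0..L}) (\<lambda>(t, x). \<psi> t x)" "0 \<le> t" for \<psi> t
      using continuous_on_slice[OF prod_cont[OF that(1)] that(2)]
      by (rule integrable_continuous_real)
    have F: "(?F has_real_derivative ?Ft t) (at t within {0..})" if t: "t \<in> {0..}" for t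
    proof (rule leibniz_rule_field_derivative[OF _ _ _ t])
      show "((\<lambda>t. ?u t x * \<phi> t x) has_real_derivative ?u s x * (\<phi>t s x - \<mu>\<^sup>2 * \<phi> s x)) (at s within {0..})"
        if "s \<in> {0..}" "x \<in> cbox 0 L" for s x
      proof -
        have "((\<lambda>s. \<phi> s x) has_real_derivative \<phi>t s x) (at s within {0..})"
          using that by (intro dt) auto
        then show ?thesis by (auto intro!: derivative_eq_intros simp: algebra_simps)
      qed
      show "(\<lambda>x. ?u s x * \<phi> s x) integrable_on cbox 0 L" if "s \<in> {0..}" for s
        using int[OF phi] that by simp
      have "continuous_on ({0..} \<times> {0..L}) (\<lambda>(t, x). \<phi>t t x - \<mu>\<^sup>2 * \<phi> t x)"
        using continuous_on_diff[OF phit continuous_on_mult[OF continuous_on_const[of _ "\<mu>\<^sup>2"] phi]]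
        by (simp add: case_prod_unfold)
      from prod_cont[OF this]
      show "continuous_on ({0..} \<times> cbox 0 L) (\<lambda>(t, x). ?u t x * (\<phi>t t x - \<mu>\<^sup>2 * \<phi> t x))"
        by simp
    qed simp
    have inner_eq: "inner_L2 L (?u t) (\<psi> t) = integral {0..L} (\<lambda>x. ?u t x * \<psi> t x)"
      if "continuous_on ({0..} \<times> {0..L}) (\<lambda>(t, x). \<psi> t x)" "0 \<le> t" for \<psi> t
      using continuous_on_slice[OF u that(2)] continuous_on_slice[OF that] by (rule inner_L2_continuous)
    have Ft: "?Ft t = ?P t" if t: "0 \<le> t" for t
    proof -
      have "((\<lambda>x. cos (\<mu> * x) * (\<phi>xx t x + \<mu>\<^sup>2 * \<phi> t x)) has_integral
          (cos (\<mu> * L) * \<phi>x t L + \<mu> * sin (\<mu> * L) * \<phi> t L)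
          - (cos (\<mu> * 0) * \<phi>x t 0 + \<mu> * sin (\<mu> * 0) * \<phi> t 0)) {0..L}"
      proof (rule fundamental_theorem_of_calculus[OF L])
        fix x assume x: "x \<in> {0..L}"
        show "((\<lambda>x. cos (\<mu> * x) * \<phi>x t x + \<mu> * sin (\<mu> * x) * \<phi> t x) has_vector_derivative
            cos (\<mu> * x) * (\<phi>xx t x + \<mu>\<^sup>2 * \<phi> t x)) (at x within {0..L})"
          unfolding has_real_derivative_iff_has_vector_derivative[symmetric]
          using dx[OF t x] dxx[OF t x]
          by (auto intro!: derivative_eq_intros simp: power2_eq_square algebra_simps)
      qed
      then have "((\<lambda>x. cos (\<mu> * x) * (\<phi>xx t x + \<mu>\<^sup>2 * \<phi> t x)) has_integral cos (\<mu> * L) * \<phi>x t L) {0..L}"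
        using bc[OF t] by simp
      from has_integral_mult_right[OF this, of "exp (- (\<mu>\<^sup>2 * t))"]
      have parts: "((\<lambda>x. ?u t x * (\<phi>xx t x + \<mu>\<^sup>2 * \<phi> t x)) has_integral ?U t * \<phi>x t L) {0..L}"
        by (simp add: mult.assoc)
      have "((\<lambda>x. ?u t x * (\<phi>t t x + \<phi>xx t x)) has_integral inner_L2 L (?u t) (\<lambda>x. \<phi>t t x + \<phi>xx t x)) {0..L}"
        using int[OF test_function_source_continuous[OF test] t]
          inner_eq[OF test_function_source_continuous[OF test] t]
        by (simp add: has_integral_integral)
      from has_integral_diff[OF this parts]
      have "((\<lambda>x. ?u t x * (\<phi>t t x - \<mu>\<^sup>2 * \<phi> t x)) has_integral ?P t) {0..L}"
        by (simp add: heat_pairing_def flip: right_diff_distrib)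
      then show ?thesis by (simp add: integral_unique)
    qed
    have "((\<lambda>t. ?P t) has_integral ?F T - ?F 0) {0..T}"
    proof (rule fundamental_theorem_of_calculus[OF T])
      fix t assume t: "t \<in> {0..T}"
      have "(?F has_real_derivative ?Ft t) (at t within {0..T})"
        by (rule has_field_derivative_subset[OF F]) (use t in auto)
      moreover have "?Ft t = ?P t" using t by (intro Ft) simp
      ultimately show "(?F has_vector_derivative ?P t) (at t within {0..T})"
        by (simp only: has_real_derivative_iff_has_vector_derivative)
    qed
    from integral_unique[OF this]
    have "(LINT t|lebesgue_on {0..T}. ?P t) = ?F T - ?F 0"
      by (simp only: LINT_interval_continuous(2)[OF heat_pairing_continuous[OF L U traj test]])
    moreover have "?F t = inner_L2 L (?u t) (\<phi> t)" if "0 \<le> t" for t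
      by (simp only: inner_eq[OF phi that] interval_cbox)
    note this[OF T] this[OF order_refl]
    ultimately show "inner_L2 L (?u T) (\<phi> T) - inner_L2 L (?u 0) (\<phi> 0) = (LINT t|lebesgue_on {0..T}. ?P t)"
      by (simp only:)
  qed
qed

lemma cos_freq_L: "L > 0 \<Longrightarrow> cos (freq L n * L) = 0"
proof -
  assume "L > 0"
  then have "freq L n * L = of_int (2 * int n + 1) * (pi / 2)" by (simp add: freq_def)
  moreover have "odd (2 * int n + 1)" by simp
  ultimately show ?thesis unfolding cos_zero_iff_int by blast
qed

text \<open>
The growing exponential makes the mode a solution of the adjoint equation \<open>\<phi>\<^sub>t + \<phi>\<^sub>x\<^sub>x = 0\<close>, so that testing
with it leaves only initial, final and boundary data.
\<close>

lemma test_function_caloric_mode: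
  assumes L: "L > 0"
  shows "test_function L (\<lambda>t x. exp ((freq L n)\<^sup>2 * t) * cos_mode L n x)
    (\<lambda>t x. exp ((freq L n)\<^sup>2 * t) * (- freq L n * sqrt (2 / L) * sin (freq L n * x)))
    (\<lambda>t x. - (freq L n)\<^sup>2 * (exp ((freq L n)\<^sup>2 * t) * cos_mode L n x))
    (\<lambda>t x. (freq L n)\<^sup>2 * (exp ((freq L n)\<^sup>2 * t) * cos_mode L n x))"
proof -
  let ?f = "freq L n"
  let ?E = "\<lambda>t. exp (?f\<^sup>2 * t)"
  have "((\<lambda>y. ?E t * (sqrt (2 / L) * cos (?f * y))) has_real_derivative
      ?E t * (- ?f * sqrt (2 / L) * sin (?f * x))) (at x within {0..L})" for t x
    by (auto intro!: derivative_eq_intros)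
  moreover have "((\<lambda>y. ?E t * (- ?f * sqrt (2 / L) * sin (?f * y))) has_real_derivative
      - ?f\<^sup>2 * (?E t * (sqrt (2 / L) * cos (?f * x)))) (at x within {0..L})" for t x
    by (auto intro!: derivative_eq_intros simp: power2_eq_square)
  moreover have "((\<lambda>s. ?E s * c) has_real_derivative ?f\<^sup>2 * (?E t * c)) (at t within {0..})" for t c
    by (auto intro!: derivative_eq_intros)
  moreover have "continuous_on S (\<lambda>p. ?E (fst p) * (sqrt (2 / L) * cos (?f * snd p)))"
    "continuous_on S (\<lambda>p. ?E (fst p) * (- ?f * sqrt (2 / L) * sin (?f * snd p)))"
    "continuous_on S (\<lambda>p. - ?f\<^sup>2 * (?E (fst p) * (sqrt (2 / L) * cos (?f * snd p))))"
    "continuous_on S (\<lambda>p. ?f\<^sup>2 * (?E (fst p) * (sqrt (2 / L) * cos (?f * snd p))))" for S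
    by (intro continuous_intros)+
  ultimately show ?thesis
    unfolding test_function_def cos_mode_def case_prod_unfold
    using cos_freq_L[OF L, of n] by simp
qed

text \<open>
Testing with the adjoint modes expresses each Fourier coefficient at time \<open>t\<close> by the initial value and the
input, which both solutions share; the coefficients determine the function up to a null set.
\<close>

lemma heat_trajectory_unique:
  assumes L: "L > 0" and u: "heat_trajectory L U u" and v: "heat_trajectory L U v"
    and init: "AE x in lebesgue_on {0..L}. u 0 x = v 0 x" and t: "0 \<le> t"
  shows "AE x in lebesgue_on {0..L}. u t x = v t x"
proof (rule cos_mode_coefficients_determine[OF L])
  show "L2_on L (u t)" "L2_on L (v t)"
    using u v t by (auto simp: heat_trajectory_def L2_trajectory_L2_on)
  fix n
  let ?E = "\<lambda>t. exp ((freq L n)\<^sup>2 * t)"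
  note test = test_function_caloric_mode[OF L, of n]
  have coeff: "?E t * inner_L2 L (w t) (cos_mode L n) - inner_L2 L (w 0) (cos_mode L n)
      = (LINT s|lebesgue_on {0..t}. - U s * (?E s * (- freq L n * sqrt (2 / L) * sin (freq L n * L))))"
    if w: "heat_trajectory L U w" for w
  proof -
    have "weak_heat_solution L U w" using w by (simp add: heat_trajectory_def)
    from this[unfolded weak_heat_solution_iff, rule_format, OF test t]
    have "inner_L2 L (w t) (\<lambda>x. ?E t * cos_mode L n x) - inner_L2 L (w 0) (\<lambda>x. ?E 0 * cos_mode L n x)
      = (LINT s|lebesgue_on {0..t}. - U s * (?E s * (- freq L n * sqrt (2 / L) * sin (freq L n * L))))"
      by (simp add: heat_pairing_def[abs_def] inner_L2_def)
    then show ?thesis by (simp only: inner_L2_cmult_right) simp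
  qed
  have "inner_L2 L (u 0) (cos_mode L n) = inner_L2 L (v 0) (cos_mode L n)"
    using u v init by (intro inner_L2_cong_AE) (auto simp: heat_trajectory_def L2_trajectory_L2_on)
  then have "?E t * inner_L2 L (u t) (cos_mode L n) = ?E t * inner_L2 L (v t) (cos_mode L n)"
    using coeff[OF u] coeff[OF v] by linarith
  then show "inner_L2 L (u t) (cos_mode L n) = inner_L2 L (v t) (cos_mode L n)" by simp
qed

section \<open>The heat semigroup\<close>

lemma norm_le_from_coefficients:
  assumes L: "L > 0" and f: "L2_on L f" and g: "L2_on L g"
    and le: "\<And>n. \<bar>inner_L2 L f (cos_mode L n)\<bar> \<le> \<bar>inner_L2 L g (cos_mode L n)\<bar>"
  shows "inner_L2 L f f \<le> inner_L2 L g g"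
  by (rule sums_le[OF _ cos_mode_Parseval[OF L f] cos_mode_Parseval[OF L g]])
    (use le in \<open>simp add: abs_le_square_iff\<close>)

lemma fourier_remainder_coefficient:
  assumes L: "L > 0" and f: "L2_on L f"
  shows "inner_L2 L (fourier_remainder L N f) (cos_mode L n)
    = (if n < N then 0 else inner_L2 L f (cos_mode L n))"
proof -
  have "L2_on L (\<lambda>x. \<Sum>n<N. inner_L2 L f (cos_mode L n) * cos_mode L n x)"
    by (intro L2_on_sum L2_on_cmult) simp
  then show ?thesis
    unfolding fourier_remainder_def using f inner_L2_cos_sum[OF L]
    by (simp add: inner_L2_diff_left)
qed

lemma fourier_remainder_tendsto_0:
  assumes L: "L > 0" and f: "L2_on L f"
  shows "(\<lambda>N. inner_L2 L (fourier_remainder L N f) (fourier_remainder L N f)) \<longlonglongrightarrow> 0"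
proof -
  have "(\<lambda>N. inner_L2 L f f - (\<Sum>n<N. (inner_L2 L f (cos_mode L n))\<^sup>2))
      \<longlonglongrightarrow> inner_L2 L f f - inner_L2 L f f"
    using cos_mode_Parseval[OF L f] unfolding sums_def by (intro tendsto_intros)
  then show ?thesis using fourier_remainder_energy[OF L f] by simp
qed

text \<open>
The semigroup of the heat equation with homogeneous boundary conditions. At \<open>t = 0\<close> the series
converges to \<open>f\<close> in general only in \<open>L\<^sup>2\<close>, so the initial value is put in by hand; for \<open>t > 0\<close> it converges uniformly.
\<close>

definition heat_flow :: "real \<Rightarrow> (real \<Rightarrow> real) \<Rightarrow> real \<Rightarrow> real \<Rightarrow> real" where
  "heat_flow L f t x = (if t = 0 then f x
     else \<Sum>n. inner_L2 L f (cos_mode L n) * exp (- ((freq L n)\<^sup>2 * t)) * cos_mode L n x)"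

text \<open>
A linear lower bound on the eigenvalues suffices to dominate the series of the semigroup by a geometric one.
\<close>

lemma freq_0_sq_mult_le:
  assumes L: "L > 0"
  shows "(freq L 0)\<^sup>2 * (1 + real n) \<le> (freq L n)\<^sup>2"
proof -
  have freq: "(freq L k)\<^sup>2 = (pi / (2 * L))\<^sup>2 * (2 * real k + 1)\<^sup>2" for k
    by (simp only: freq_def power_mult_distrib mult.commute)
  have "1 + real n \<le> (2 * real n + 1)\<^sup>2"
    using mult_nonneg_nonneg[of "real n" "real n"] by (simp add: power2_eq_square algebra_simps)
  then have "(pi / (2 * L))\<^sup>2 * (1 + real n) \<le> (pi / (2 * L))\<^sup>2 * (2 * real n + 1)\<^sup>2"
    by (intro mult_left_mono) auto
  then show ?thesis unfolding freq by simp
qed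

lemma freq_0_sq_le: "L > 0 \<Longrightarrow> (freq L 0)\<^sup>2 \<le> (freq L n)\<^sup>2"
  using freq_0_sq_mult_le[of L n] mult_left_mono[of 1 "1 + real n" "(freq L 0)\<^sup>2"] by simp

lemma heat_flow_series_uniform:
  assumes L: "L > 0" and f: "L2_on L f" and t: "0 < t"
  shows "uniform_limit UNIV
    (\<lambda>N x. \<Sum>n<N. inner_L2 L f (cos_mode L n) * exp (- ((freq L n)\<^sup>2 * t)) * cos_mode L n x)
    (heat_flow L f t) sequentially"
proof -
  let ?r = "exp (- ((freq L 0)\<^sup>2 * t))"
  let ?C = "sqrt (inner_L2 L f f) * sqrt (2 / L)"
  have "0 < (freq L 0)\<^sup>2 * t" using t L by (simp add: freq_def)
  then have r: "?r < 1" by simp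
  have "uniform_limit UNIV
    (\<lambda>N x. \<Sum>n<N. inner_L2 L f (cos_mode L n) * exp (- ((freq L n)\<^sup>2 * t)) * cos_mode L n x)
    (\<lambda>x. \<Sum>n. inner_L2 L f (cos_mode L n) * exp (- ((freq L n)\<^sup>2 * t)) * cos_mode L n x) sequentially"
  proof (rule Weierstrass_m_test[where M = "\<lambda>n. ?C * ?r ^ n"])
    show "summable (\<lambda>n. ?C * ?r ^ n)" using r by (intro summable_mult summable_geometric) simp
    fix n x
    have "\<bar>inner_L2 L f (cos_mode L n)\<bar> \<le> sqrt (inner_L2 L f f)"
      using abs_inner_L2_le[OF f L2_on_cos_mode, of n] cos_mode_orthonormal[OF L, of n n] by simp
    moreover have "exp (- ((freq L n)\<^sup>2 * t)) \<le> ?r ^ n"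
    proof -
      have "(freq L 0)\<^sup>2 * real n \<le> (freq L n)\<^sup>2"
        by (rule order_trans[OF mult_left_mono freq_0_sq_mult_le[OF L, of n]]) auto
      then have "(freq L 0)\<^sup>2 * real n * t \<le> (freq L n)\<^sup>2 * t"
        using t by (intro mult_right_mono) auto
      moreover have "?r ^ n = exp (- ((freq L 0)\<^sup>2 * real n * t))"
        by (simp add: exp_of_nat_mult[symmetric] algebra_simps)
      ultimately show ?thesis by simp
    qed
    moreover have "\<bar>cos_mode L n x\<bar> \<le> sqrt (2 / L)"
      using L mult_left_mono[OF abs_cos_le_one, of "sqrt (2 / L)" "freq L n * x"]
      by (simp add: cos_mode_def abs_mult)
    ultimately have "\<bar>inner_L2 L f (cos_mode L n)\<bar> * exp (- ((freq L n)\<^sup>2 * t)) * \<bar>cos_mode L n x\<bar>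
        \<le> sqrt (inner_L2 L f f) * ?r ^ n * sqrt (2 / L)"
      using inner_L2_self_nonneg[of L f] by (intro mult_mono) auto
    then show "norm (inner_L2 L f (cos_mode L n) * exp (- ((freq L n)\<^sup>2 * t)) * cos_mode L n x) \<le> ?C * ?r ^ n"
      by (simp add: abs_mult mult_ac)
  qed
  then show ?thesis using t by (simp add: heat_flow_def[abs_def])
qed

lemma heat_flow_L2_on:
  assumes L: "L > 0" and f: "L2_on L f" and t: "0 \<le> t"
  shows "L2_on L (heat_flow L f t)"
proof (cases "t = 0")
  case True
  then show ?thesis using f by (simp add: heat_flow_def[abs_def])
next
  case False
  then have "uniform_limit {0..L}
    (\<lambda>N x. \<Sum>n<N. inner_L2 L f (cos_mode L n) * exp (- ((freq L n)\<^sup>2 * t)) * cos_mode L n x)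
    (heat_flow L f t) sequentially"
    using heat_flow_series_uniform[OF L f, of t] t uniform_limit_on_subset by fastforce
  then show ?thesis
    by (intro L2_on_continuous uniform_limit_theorem)
      (auto intro!: always_eventually continuous_intros)
qed

text \<open>
For \<open>t > 0\<close> the series converges uniformly, hence in \<open>L\<^sup>2\<close>, so coefficients may be taken term by term.
\<close>

lemma heat_flow_coefficient:
  assumes L: "L > 0" and f: "L2_on L f" and t: "0 \<le> t"
  shows "inner_L2 L (heat_flow L f t) (cos_mode L m)
    = exp (- ((freq L m)\<^sup>2 * t)) * inner_L2 L f (cos_mode L m)"
proof (cases "t = 0")
  case True
  then show ?thesis by (simp add: heat_flow_def[abs_def])
next
  case False
  with t have t: "0 < t" by simp
  let ?S = "\<lambda>N x. \<Sum>n<N. inner_L2 L f (cos_mode L n) * exp (- ((freq L n)\<^sup>2 * t)) * cos_mode L n x"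
  note flow = heat_flow_L2_on[OF L f, of t]
  have S: "L2_on L (?S N)" for N by (intro L2_on_sum L2_on_cmult) simp
  have lim: "(\<lambda>N. inner_L2 L (?S N) (cos_mode L m)) \<longlonglongrightarrow> inner_L2 L (heat_flow L f t) (cos_mode L m)"
  proof (rule LIMSEQ_I)
    fix \<epsilon> :: real assume e: "\<epsilon> > 0"
    let ?d = "\<epsilon> / (2 * sqrt L)"
    have "?d > 0" using e L by simp
    then obtain N0 where N0: "\<And>N x. N \<ge> N0 \<Longrightarrow> \<bar>?S N x - heat_flow L f t x\<bar> < ?d"
      using heat_flow_series_uniform[OF L f t]
      unfolding uniform_limit_iff eventually_sequentially dist_real_def by blast
    have "norm (inner_L2 L (?S N) (cos_mode L m) - inner_L2 L (heat_flow L f t) (cos_mode L m)) < \<epsilon>"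
      if "N \<ge> N0" for N
    proof -
      let ?D = "\<lambda>x. ?S N x - heat_flow L f t x"
      have D: "L2_on L ?D" using S flow t by (intro L2_on_diff) auto
      have "\<bar>inner_L2 L ?D (cos_mode L m)\<bar> \<le> sqrt (inner_L2 L ?D ?D)"
        using abs_inner_L2_le[OF D L2_on_cos_mode, of m] cos_mode_orthonormal[OF L, of m m] by simp
      also have "\<dots> \<le> sqrt (L * ?d\<^sup>2)"
        using N0[OF that] L
        by (intro real_sqrt_le_mono inner_L2_self_le_bound D) (auto intro: less_imp_le)
      also have "\<dots> = \<epsilon> / 2" using e L by (simp add: real_sqrt_mult real_sqrt_divide)
      also have "\<dots> < \<epsilon>" using e by simp
      finally show ?thesis using S flow t by (simp add: inner_L2_diff_left)
    qed
    then show "\<exists>N0. \<forall>N\<ge>N0. norm (inner_L2 L (?S N) (cos_mode L m)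
        - inner_L2 L (heat_flow L f t) (cos_mode L m)) < \<epsilon>" by blast
  qed
  have "\<forall>\<^sub>F N in sequentially. inner_L2 L (?S N) (cos_mode L m)
      = inner_L2 L f (cos_mode L m) * exp (- ((freq L m)\<^sup>2 * t))"
    using inner_L2_cos_sum[OF L] by (intro eventually_sequentiallyI[of "Suc m"]) simp
  from LIMSEQ_unique[OF lim tendsto_eventually[OF this]] show ?thesis by (simp only: mult.commute)
qed

text \<open>
Every coefficient of the state at time \<open>t\<close> is dominated by that of \<open>exp (- \<omega>\<^sub>0\<^sup>2 t) f\<close>.
\<close>

lemma heat_flow_decay:
  assumes L: "L > 0" and f: "L2_on L f" and t: "0 \<le> t"
  shows "inner_L2 L (heat_flow L f t) (heat_flow L f t) \<le> exp (- (2 * (freq L 0)\<^sup>2 * t)) * inner_L2 L f f"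
proof -
  let ?E = "exp (- ((freq L 0)\<^sup>2 * t))"
  have "inner_L2 L (heat_flow L f t) (heat_flow L f t) \<le> inner_L2 L (\<lambda>x. ?E * f x) (\<lambda>x. ?E * f x)"
  proof (rule norm_le_from_coefficients[OF L heat_flow_L2_on[OF L f t] L2_on_cmult[OF f]])
    fix n
    have "(freq L 0)\<^sup>2 * t \<le> (freq L n)\<^sup>2 * t" using freq_0_sq_le[OF L] t by (rule mult_right_mono)
    then show "\<bar>inner_L2 L (heat_flow L f t) (cos_mode L n)\<bar> \<le> \<bar>inner_L2 L (\<lambda>x. ?E * f x) (cos_mode L n)\<bar>"
      using heat_flow_coefficient[OF L f t]
      by (simp add: inner_L2_cmult_left abs_mult mult_right_mono)
  qed
  also have "\<dots> = exp (- (2 * (freq L 0)\<^sup>2 * t)) * inner_L2 L f f"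
    by (simp add: inner_L2_cmult_left inner_L2_cmult_right flip: mult.assoc exp_add)
  finally show ?thesis .
qed

text \<open>
By Parseval the squared distance of the states at times \<open>s\<close> and \<open>t\<close> is a series of continuous functions of
\<open>s\<close>, dominated termwise by the squared coefficients of \<open>f\<close>. This includes \<open>t = 0\<close>.
\<close>

lemma heat_flow_L2_trajectory:
  assumes L: "L > 0" and f: "L2_on L f"
  shows "L2_trajectory L (heat_flow L f)"
  unfolding L2_trajectory_def
proof (intro conjI allI impI)
  fix t :: real assume t: "0 \<le> t"
  show "L2_on L (heat_flow L f t)" using L f t by (rule heat_flow_L2_on)
  let ?a = "\<lambda>n s. (exp (- ((freq L n)\<^sup>2 * s)) - exp (- ((freq L n)\<^sup>2 * t))) * inner_L2 L f (cos_mode L n)"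
  let ?D = "\<lambda>s x. heat_flow L f s x - heat_flow L f t x"
  have D: "inner_L2 L (?D s) (?D s) = (\<Sum>n. (?a n s)\<^sup>2)" if s: "0 \<le> s" for s
  proof -
    have "L2_on L (?D s)" using heat_flow_L2_on[OF L f] s t by (intro L2_on_diff)
    from sums_unique[OF cos_mode_Parseval[OF L this]] show ?thesis
      using heat_flow_L2_on[OF L f] heat_flow_coefficient[OF L f] s t
      by (simp add: inner_L2_diff_left left_diff_distrib)
  qed
  have "uniform_limit {0..} (\<lambda>N s. \<Sum>n<N. (?a n s)\<^sup>2) (\<lambda>s. \<Sum>n. (?a n s)\<^sup>2) sequentially"
  proof (rule Weierstrass_m_test[where M = "\<lambda>n. (inner_L2 L f (cos_mode L n))\<^sup>2"])
    show "summable (\<lambda>n. (inner_L2 L f (cos_mode L n))\<^sup>2)"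
      using cos_mode_Parseval[OF L f] by (rule sums_summable)
    fix n and s :: real assume "s \<in> {0..}"
    then have "exp (- ((freq L n)\<^sup>2 * s)) \<le> 1" "exp (- ((freq L n)\<^sup>2 * t)) \<le> 1" using t by auto
    moreover have "exp (- ((freq L n)\<^sup>2 * s)) > 0" "exp (- ((freq L n)\<^sup>2 * t)) > 0" by auto
    ultimately have "\<bar>exp (- ((freq L n)\<^sup>2 * s)) - exp (- ((freq L n)\<^sup>2 * t))\<bar> \<le> 1" by linarith
    then have "\<bar>?a n s\<bar> \<le> 1 * \<bar>inner_L2 L f (cos_mode L n)\<bar>"
      unfolding abs_mult by (rule mult_right_mono) simp
    then show "norm ((?a n s)\<^sup>2) \<le> (inner_L2 L f (cos_mode L n))\<^sup>2"
      by (simp add: abs_le_square_iff)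
  qed
  then have "continuous_on {0..} (\<lambda>s. \<Sum>n. (?a n s)\<^sup>2)"
    by (rule uniform_limit_theorem[rotated]) (auto intro!: always_eventually continuous_intros)
  moreover have "t \<in> {0..}" using t by simp
  ultimately have "((\<lambda>s. \<Sum>n. (?a n s)\<^sup>2) \<longlongrightarrow> (\<Sum>n. (?a n t)\<^sup>2)) (at t within {0..})"
    unfolding continuous_on_def by (rule bspec)
  then have lim: "((\<lambda>s. \<Sum>n. (?a n s)\<^sup>2) \<longlongrightarrow> 0) (at t within {0..})" by simp
  show "((\<lambda>s. inner_L2 L (?D s) (?D s)) \<longlongrightarrow> 0) (at t within {0..})"
    by (rule Lim_transform_eventually[OF lim])
      (use D in \<open>auto simp: eventually_at_filter\<close>)
qed

lemma heat_trajectory_cosine_partial_sum: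
  assumes L: "L > 0"
  shows "heat_trajectory L (\<lambda>t. 0)
    (\<lambda>t x. \<Sum>n<N. a n * exp (- ((freq L n)\<^sup>2 * t)) * cos_mode L n x)"
proof (induction N)
  case 0
  have "heat_trajectory L (\<lambda>t. 0 * (exp (- (0\<^sup>2 * t)) * cos (0 * L))) (\<lambda>t x. 0 * (exp (- (0\<^sup>2 * t)) * cos (0 * x)))"
    using L by (intro heat_trajectory_cmult heat_trajectory_separated_mode) simp
  then show ?case by simp
next
  case (Suc N)
  have "heat_trajectory L (\<lambda>t. (a N * sqrt (2 / L)) * (exp (- ((freq L N)\<^sup>2 * t)) * cos (freq L N * L)))
     (\<lambda>t x. (a N * sqrt (2 / L)) * (exp (- ((freq L N)\<^sup>2 * t)) * cos (freq L N * x)))"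
    using L by (intro heat_trajectory_cmult heat_trajectory_separated_mode) simp
  then have mode: "heat_trajectory L (\<lambda>t. 0) (\<lambda>t x. a N * exp (- ((freq L N)\<^sup>2 * t)) * cos_mode L N x)"
    using cos_freq_L[OF L] by (simp add: cos_mode_def mult_ac)
  show ?case using heat_trajectory_add[OF _ Suc.IH mode] L by simp
qed

text \<open>
The partial sums are weak solutions as finite combinations of eigenmodes. Their distance to the series is a
Fourier remainder whose coefficients are, at every time, bounded by those of the remainder of \<open>f\<close>; this is
the uniform convergence required to pass to the limit.
\<close>

lemma heat_flow_heat_trajectory:
  assumes L: "L > 0" and f: "L2_on L f"
  shows "heat_trajectory L (\<lambda>t. 0) (heat_flow L f)"
proof (rule heat_trajectory_limit)
  show "0 \<le> L" using L by simp
  show "heat_trajectory L (\<lambda>t. 0)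
      (\<lambda>t x. \<Sum>n<N. inner_L2 L f (cos_mode L n) * exp (- ((freq L n)\<^sup>2 * t)) * cos_mode L n x)" for N
    using L by (rule heat_trajectory_cosine_partial_sum)
  show "L2_trajectory L (heat_flow L f)" using L f by (rule heat_flow_L2_trajectory)
  show "(\<lambda>N. inner_L2 L (fourier_remainder L N f) (fourier_remainder L N f)) \<longlonglongrightarrow> 0"
    using L f by (rule fourier_remainder_tendsto_0)
  fix N and t :: real assume t: "0 \<le> t"
  note flow = heat_flow_L2_on[OF L f t]
  have "(\<lambda>x. heat_flow L f t x
      - (\<Sum>n<N. inner_L2 L f (cos_mode L n) * exp (- ((freq L n)\<^sup>2 * t)) * cos_mode L n x))
    = fourier_remainder L N (heat_flow L f t)" (is "?R = _")
    by (simp add: fourier_remainder_def heat_flow_coefficient[OF L f t] fun_eq_iff mult_ac)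
  moreover have "inner_L2 L (fourier_remainder L N (heat_flow L f t)) (fourier_remainder L N (heat_flow L f t))
      \<le> inner_L2 L (fourier_remainder L N f) (fourier_remainder L N f)"
  proof (rule norm_le_from_coefficients[OF L])
    fix n
    have "exp (- ((freq L n)\<^sup>2 * t)) \<le> 1" using t by simp
    then have "exp (- ((freq L n)\<^sup>2 * t)) * \<bar>inner_L2 L f (cos_mode L n)\<bar> \<le> 1 * \<bar>inner_L2 L f (cos_mode L n)\<bar>"
      by (rule mult_right_mono) simp
    then show "\<bar>inner_L2 L (fourier_remainder L N (heat_flow L f t)) (cos_mode L n)\<bar>
        \<le> \<bar>inner_L2 L (fourier_remainder L N f) (cos_mode L n)\<bar>"
      by (simp add: fourier_remainder_coefficient[OF L] f flow heat_flow_coefficient[OF L f t] abs_mult)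
  qed (intro L2_on_fourier_remainder f flow)+
  ultimately show "inner_L2 L ?R ?R \<le> inner_L2 L (fourier_remainder L N f) (fourier_remainder L N f)"
    by simp
qed

section \<open>The closed loop\<close>

lemma heat_trajectory_cong:
  assumes u: "heat_trajectory L U u" and eq: "\<And>t. 0 \<le> t \<Longrightarrow> U t = V t"
  shows "heat_trajectory L V u"
  unfolding heat_trajectory_def
proof (intro conjI)
  show "continuous_on {0..} V"
    using u eq continuous_on_eq[of "{0..}" U V] by (simp add: heat_trajectory_def)
  show "L2_trajectory L u" using u by (simp add: heat_trajectory_def)
  have "(LINT t|lebesgue_on {0..T}. heat_pairing L V u \<phi>x \<phi>xx \<phi>t t)
      = (LINT t|lebesgue_on {0..T}. heat_pairing L U u \<phi>x \<phi>xx \<phi>t t)" for T \<phi>x \<phi>xx \<phi>t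
    using eq by (intro Bochner_Integration.integral_cong) (auto simp: heat_pairing_def)
  moreover have "weak_heat_solution L U u" using u by (simp add: heat_trajectory_def)
  ultimately show "weak_heat_solution L V u" unfolding weak_heat_solution_iff by simp
qed

lemma has_derivative_from_integral:
  fixes F f :: "real \<Rightarrow> real"
  assumes f: "continuous_on {0..} f"
    and F: "\<And>T. 0 \<le> T \<Longrightarrow> F T - F 0 = (LINT t|lebesgue_on {0..T}. f t)"
    and t: "0 \<le> t"
  shows "(F has_real_derivative f t) (at t within {0..})"
proof -
  have "((\<lambda>T. integral {0..T} f) has_real_derivative f t) (at t within {0..t + 1})"
    using t f by (intro integral_has_real_derivative) (auto intro: continuous_on_subset)
  then have "((\<lambda>T. F 0 + integral {0..T} f) has_real_derivative f t) (at t within {0..t + 1})"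
    by (auto intro!: derivative_eq_intros)
  \<comment> \<open>Within distance \<open>1\<close> of \<open>t\<close> the compact interval and the half-line agree, so the derivatives do as well.\<close>
  moreover have "at t within {0..t + 1} = at t within {0..}"
    by (rule at_within_nhd[of _ "{..<t + 1}"]) auto
  ultimately have der: "((\<lambda>T. F 0 + integral {0..T} f) has_real_derivative f t) (at t within {0..})"
    by simp
  have eq: "F T = F 0 + integral {0..T} f" if "T \<in> {0..}" for T
    using F[of T] LINT_interval_continuous(2)[OF f, of T] that by simp
  have "t \<in> {0..}" using t by simp
  from has_derivative_transform[OF this eq der[unfolded has_field_derivative_def]] show ?thesis
    unfolding has_field_derivative_def .
qed

lemma g_kernel_continuous: "continuous_on S (g_kernel L)"
  unfolding g_kernel_def[abs_def] by (intro continuous_intros)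

lemma g_kernel_L2_on [simp]: "L2_on L (g_kernel L)"
  by (intro L2_on_continuous g_kernel_continuous)

text \<open>
The boundary conditions \<open>g'(0) = 0\<close> and \<open>g(L) = 0\<close> are those of test functions.
\<close>

lemma test_function_g_kernel:
  assumes "L > 0"
  shows "test_function L (\<lambda>t. g_kernel L) (\<lambda>t x. - x) (\<lambda>t x. -1) (\<lambda>t x. 0)"
proof -
  have "(g_kernel L has_real_derivative - x) (at x within {0..L})" for x
    unfolding g_kernel_def[abs_def] by (auto intro!: derivative_eq_intros)
  moreover have "(uminus has_real_derivative -1) (at x within {0..L})" for x :: real
    by (auto intro!: derivative_eq_intros)
  moreover have "continuous_on S (\<lambda>p::real \<times> real. g_kernel L (snd p))"
    "continuous_on S (\<lambda>p::real \<times> real. - snd p)" for S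
    unfolding g_kernel_def by (intro continuous_intros; simp)+
  ultimately show ?thesis
    unfolding test_function_def case_prod_unfold by (simp add: g_kernel_def[of L L])
qed

lemma mean_continuous:
  assumes "L2_trajectory L u"
  shows "continuous_on {0..} (\<lambda>t. LINT y|lebesgue_on {0..L}. u t y)"
proof -
  have "continuous_on ({0..} \<times> {0..L}) (\<lambda>(t::real, x::real). 1::real)" by (simp add: case_prod_unfold)
  from L2_trajectory_pairing_continuous[OF assms this] show ?thesis by (simp add: inner_L2_def)
qed

lemma g_kernel_pairing_continuous:
  assumes "L2_trajectory L u"
  shows "continuous_on {0..} (\<lambda>t. inner_L2 L (g_kernel L) (u t))"
proof -
  have "continuous_on ({0..} \<times> {0..L}) (\<lambda>(t::real, x). g_kernel L x)"
    unfolding case_prod_unfold g_kernel_def by (intro continuous_intros; simp)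
  from L2_trajectory_pairing_continuous[OF assms this]
  show ?thesis by (simp only: inner_L2_commute[of L "g_kernel L"])
qed

text \<open>
In the weak form, \<open>g'' = -1\<close> produces the mean of \<open>u\<close> and \<open>g'(L) = - L\<close> produces the input.
\<close>

lemma g_kernel_pairing_derivative:
  assumes L: "L > 0" and u: "heat_trajectory L U u" and t: "0 \<le> t"
  shows "((\<lambda>t. inner_L2 L (g_kernel L) (u t)) has_real_derivative
    L * U t - (LINT y|lebesgue_on {0..L}. u t y)) (at t within {0..})"
proof (rule has_derivative_from_integral[OF _ _ t])
  have U: "continuous_on {0..} U" and traj: "L2_trajectory L u" and weak: "weak_heat_solution L U u"
    using u by (auto simp: heat_trajectory_def)
  show "continuous_on {0..} (\<lambda>t. L * U t - (LINT y|lebesgue_on {0..L}. u t y))"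
    by (intro continuous_on_diff continuous_on_mult continuous_on_const U mean_continuous[OF traj])
  fix T :: real assume T: "0 \<le> T"
  have "heat_pairing L U u (\<lambda>t x. - x) (\<lambda>t x. -1) (\<lambda>t x. 0)
      = (\<lambda>t. L * U t - (LINT y|lebesgue_on {0..L}. u t y))"
    by (simp add: heat_pairing_def fun_eq_iff inner_L2_def)
  with weak[unfolded weak_heat_solution_iff, rule_format, OF test_function_g_kernel[OF L] T]
  show "inner_L2 L (g_kernel L) (u T) - inner_L2 L (g_kernel L) (u 0)
      = (LINT t|lebesgue_on {0..T}. L * U t - (LINT y|lebesgue_on {0..L}. u t y))"
    by (simp only: inner_L2_commute[of L "g_kernel L"])
qed

lemma Z_state_inner: "Z_state L \<theta> u t = \<theta> t + inner_L2 L (g_kernel L) (u t)"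
  by (simp add: Z_state_def inner_L2_def)

lemma cascade_heat_trajectory:
  assumes "cascade_solution L U \<theta> u" "continuous_on {0..} U"
  shows "heat_trajectory L U u"
  using assms by (simp add: cascade_solution_def heat_trajectory_def continuous_state_iff)

lemma Z_state_continuous:
  assumes "continuous_state L \<theta> u"
  shows "continuous_on {0..} (Z_state L \<theta> u)"
  using assms unfolding continuous_state_iff
  by (auto simp: Z_state_inner[abs_def] intro!: continuous_on_add g_kernel_pairing_continuous)

text \<open>
The mean of \<open>u\<close> in the ODE cancels against the mean produced by \<open>g'' = -1\<close>. This holds for any
continuous input, so the feedback law turns it into a scalar linear ODE for \<open>Z\<close>.
\<close>

lemma cascade_Z_state_derivative:
  assumes L: "L > 0" and sol: "cascade_solution L U \<theta> u" and U: "continuous_on {0..} U" and t: "0 \<le> t"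
  shows "(Z_state L \<theta> u has_real_derivative L * U t) (at t within {0..})"
proof -
  have "(\<theta> has_real_derivative (LINT y|lebesgue_on {0..L}. u t y)) (at t within {0..})"
    using sol t by (simp add: cascade_solution_def)
  from DERIV_add[OF this g_kernel_pairing_derivative[OF L cascade_heat_trajectory[OF sol U] t]]
  show ?thesis by (simp add: Z_state_inner[abs_def])
qed

lemma linear_ODE_solution:
  fixes z :: "real \<Rightarrow> real"
  assumes z: "\<And>t. 0 \<le> t \<Longrightarrow> (z has_real_derivative a * z t) (at t within {0..})" and t: "0 \<le> t"
  shows "z t = z 0 * exp (a * t)"
proof -
  \<comment> \<open>The integrating factor makes the derivative vanish.\<close>
  have "((\<lambda>t. z t * exp (- (a * t))) has_real_derivative 0) (at s within {0..})" if "s \<in> {0..}" for s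
    using z[of s] that by (auto intro!: derivative_eq_intros)
  from has_field_derivative_zero_constant[OF _ this, simplified]
  obtain c where c: "\<And>s. 0 \<le> s \<Longrightarrow> z s * exp (- (a * s)) = c" by auto
  have "z t * exp (- (a * t)) = z 0" using c[OF t] c[of 0] by simp
  then show ?thesis by (simp add: exp_minus field_simps)
qed

text \<open>
The solution of \<open>p'' = L K p\<close>, \<open>p'(0) = 0\<close>, \<open>p(L) = 1\<close>: the spatial shape of the response to the boundary
input \<open>exp (L K t)\<close>.
\<close>

definition profile :: "real \<Rightarrow> real \<Rightarrow> real \<Rightarrow> real" where
  "profile L K x = cos (sqrt (- (L * K)) * x) / cos (sqrt (- (L * K)) * L)"

definition closed_loop_state :: "real \<Rightarrow> real \<Rightarrow> real \<Rightarrow> (real \<Rightarrow> real) \<Rightarrow> real \<Rightarrow> real \<Rightarrow> real" where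
  "closed_loop_state L K Z0 u0 t x = K * Z0 * exp (L * K * t) * profile L K x
     + heat_flow L (\<lambda>x. u0 x - K * Z0 * profile L K x) t x"

lemma profile_L2_on [simp]: "L2_on L (profile L K)"
  unfolding profile_def[abs_def]
  by (cases "cos (sqrt (- (L * K)) * L) = 0") (auto intro!: L2_on_continuous continuous_intros)

text \<open>
A zero would give \<open>\<mu> L = (2 \<kappa> + 1) \<pi> / 2\<close> with \<open>\<mu>\<^sup>2 = - L K\<close>, and squaring turns this into one of the
excluded gains: the input would decay at exactly the rate of an eigenmode.
\<close>

lemma cos_at_L_nonzero:
  assumes "L > 0" "K < 0"
    and "\<And>\<kappa>::nat. K \<noteq> - ((2 * real \<kappa> + 1)\<^sup>2 * pi\<^sup>2 / (4 * L ^ 3))"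
  shows "cos (sqrt (- (L * K)) * L) \<noteq> 0"
proof
  let ?\<mu> = "sqrt (- (L * K))"
  have pos: "0 < - (L * K)" using assms by (simp add: mult_pos_neg)
  assume "cos (?\<mu> * L) = 0"
  then obtain i where i: "odd i" "?\<mu> * L = of_int i * (pi / 2)" using cos_zero_iff_int by blast
  have "0 < ?\<mu> * L" using pos assms(1) by (intro mult_pos_pos) simp_all
  then have "0 < of_int i * (pi / 2)" by (simp only: i(2))
  then have "0 < i" by (simp add: zero_less_mult_iff)
  obtain k where k: "i = 2 * k + 1" using i(1) by (rule oddE)
  with \<open>0 < i\<close> have "0 \<le> k" by presburger
  then obtain \<kappa> :: nat where "k = int \<kappa>" by (rule nonneg_int_cases)
  with k have \<kappa>: "i = 2 * int \<kappa> + 1" by simp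
  have "- (L * K) * L\<^sup>2 = (?\<mu> * L)\<^sup>2" using pos by (simp add: power_mult_distrib)
  also have "\<dots> = (2 * real \<kappa> + 1)\<^sup>2 * pi\<^sup>2 / 4"
    unfolding i(2) \<kappa> by (simp add: power_mult_distrib power_divide)
  finally have "K = - ((2 * real \<kappa> + 1)\<^sup>2 * pi\<^sup>2 / (4 * L ^ 3))"
    using assms(1) by (simp add: field_simps power3_eq_cube power2_eq_square)
  then show False using assms(3) by blast
qed

lemma closed_loop_state_heat_trajectory:
  assumes L: "L > 0" and K: "K < 0" and nonres: "cos (sqrt (- (L * K)) * L) \<noteq> 0" and u0: "L2_on L u0"
  shows "heat_trajectory L (\<lambda>t. K * (Z0 * exp (L * K * t))) (closed_loop_state L K Z0 u0)"
proof -
  let ?\<mu> = "sqrt (- (L * K))"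
  let ?c = "K * Z0 / cos (?\<mu> * L)"
  have sq: "- (?\<mu>\<^sup>2 * t) = L * K * t" for t
    using L K by (simp add: mult_pos_neg less_imp_le)
  have "heat_trajectory L (\<lambda>t. ?c * (exp (- (?\<mu>\<^sup>2 * t)) * cos (?\<mu> * L)))
      (\<lambda>t x. ?c * (exp (- (?\<mu>\<^sup>2 * t)) * cos (?\<mu> * x)))"
    using L by (intro heat_trajectory_cmult heat_trajectory_separated_mode) simp
  moreover have "(\<lambda>t. ?c * (exp (- (?\<mu>\<^sup>2 * t)) * cos (?\<mu> * L))) = (\<lambda>t. K * (Z0 * exp (L * K * t)))"
    unfolding sq using nonres by (simp add: fun_eq_iff)
  moreover have "(\<lambda>t x. ?c * (exp (- (?\<mu>\<^sup>2 * t)) * cos (?\<mu> * x)))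
      = (\<lambda>t x. K * Z0 * exp (L * K * t) * profile L K x)"
    unfolding sq by (simp add: fun_eq_iff profile_def)
  ultimately have "heat_trajectory L (\<lambda>t. K * (Z0 * exp (L * K * t)))
      (\<lambda>t x. K * Z0 * exp (L * K * t) * profile L K x)" by simp
  moreover have "heat_trajectory L (\<lambda>t. 0) (heat_flow L (\<lambda>x. u0 x - K * Z0 * profile L K x))"
    using L u0 by (intro heat_flow_heat_trajectory L2_on_diff L2_on_cmult) auto
  ultimately have "heat_trajectory L (\<lambda>t. K * (Z0 * exp (L * K * t)) + 0)
      (\<lambda>t x. K * Z0 * exp (L * K * t) * profile L K x + heat_flow L (\<lambda>x. u0 x - K * Z0 * profile L K x) t x)"
    using L by (intro heat_trajectory_add) auto
  then show ?thesis by (simp add: closed_loop_state_def[abs_def])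
qed

lemma closed_loop_state_0: "closed_loop_state L K Z0 u0 0 = u0"
  by (simp add: closed_loop_state_def heat_flow_def fun_eq_iff)

text \<open>
Defining \<open>\<theta>\<close> as the prescribed exponential minus \<open>\<integral> g u\<close> makes the feedback identity hold by construction; what
remains to check is the ODE, and that is the computation of the derivative of \<open>\<integral> g u\<close> read backwards.
\<close>

lemma closed_loop_solution_exists:
  fixes \<theta>0 :: real
  assumes L: "L > 0" and K: "K < 0" and nonres: "cos (sqrt (- (L * K)) * L) \<noteq> 0" and u0: "L2_on L u0"
  defines "Z0 \<equiv> \<theta>0 + inner_L2 L (g_kernel L) u0"
  defines "u \<equiv> closed_loop_state L K Z0 u0"
  shows "closed_loop_solution L K \<theta>0 u0 (\<lambda>t. Z0 * exp (L * K * t) - inner_L2 L (g_kernel L) (u t)) u"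
    (is "closed_loop_solution L K \<theta>0 u0 ?\<theta> u")
proof -
  have Z: "Z_state L ?\<theta> u = (\<lambda>t. Z0 * exp (L * K * t))"
    by (simp add: Z_state_inner fun_eq_iff)
  have heat: "heat_trajectory L (\<lambda>t. K * (Z0 * exp (L * K * t))) u"
    unfolding u_def using L K nonres u0 by (rule closed_loop_state_heat_trajectory)
  then have traj: "L2_trajectory L u" and weak: "weak_heat_solution L (\<lambda>t. K * (Z0 * exp (L * K * t))) u"
    by (auto simp: heat_trajectory_def)
  have "continuous_on {0..} ?\<theta>"
    by (intro continuous_on_diff g_kernel_pairing_continuous[OF traj] continuous_intros)
  moreover have "(?\<theta> has_real_derivative (LINT y|lebesgue_on {0..L}. u t y)) (at t within {0..})"
    if t: "0 \<le> t" for t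
  proof -
    have "((\<lambda>t. Z0 * exp (L * K * t)) has_real_derivative L * (K * (Z0 * exp (L * K * t)))) (at t within {0..})"
      by (auto intro!: derivative_eq_intros)
    from DERIV_diff[OF this g_kernel_pairing_derivative[OF L heat t]] show ?thesis by simp
  qed
  moreover have "?\<theta> 0 = \<theta>0" "u 0 = u0"
    by (simp_all add: u_def closed_loop_state_0 Z0_def)
  ultimately show ?thesis
    unfolding closed_loop_solution_def cascade_solution_def continuous_state_iff Z
    using traj weak by simp
qed

text \<open>
The scalar ODE for \<open>Z\<close> makes the boundary input of an arbitrary solution explicit, and uniqueness for the heat
equation with given input does the rest.
\<close>

lemma closed_loop_solution_formula:
  fixes \<theta>0 :: real
  assumes L: "L > 0" and K: "K < 0" and nonres: "cos (sqrt (- (L * K)) * L) \<noteq> 0" and u0: "L2_on L u0"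
    and sol: "closed_loop_solution L K \<theta>0 u0 \<theta> u" and t: "0 \<le> t"
  defines "Z0 \<equiv> \<theta>0 + inner_L2 L (g_kernel L) u0"
  defines "v \<equiv> closed_loop_state L K Z0 u0"
  shows "AE x in lebesgue_on {0..L}. u t x = v t x"
    and "\<theta> t = Z0 * exp (L * K * t) - inner_L2 L (g_kernel L) (v t)"
proof -
  let ?Z = "Z_state L \<theta> u"
  have casc: "cascade_solution L (\<lambda>t. K * ?Z t) \<theta> u" and \<theta>0: "\<theta> 0 = \<theta>0"
    and init: "AE x in lebesgue_on {0..L}. u 0 x = u0 x"
    using sol by (auto simp: closed_loop_solution_def)
  have state: "continuous_state L \<theta> u" using casc by (simp add: cascade_solution_def)
  then have traj: "L2_trajectory L u" by (simp add: continuous_state_iff)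
  have KZ: "continuous_on {0..} (\<lambda>t. K * ?Z t)"
    by (intro continuous_on_mult continuous_on_const Z_state_continuous[OF state])
  have "(?Z has_real_derivative L * K * ?Z s) (at s within {0..})" if "0 \<le> s" for s
    using cascade_Z_state_derivative[OF L casc KZ that] by (simp add: mult.assoc)
  then have "?Z s = ?Z 0 * exp (L * K * s)" if "0 \<le> s" for s
    using that by (rule linear_ODE_solution)
  moreover have "?Z 0 = Z0"
    using inner_L2_cong_AE[OF L2_trajectory_L2_on[OF traj order_refl] u0 g_kernel_L2_on init]
    by (simp add: Z_state_inner Z0_def \<theta>0 inner_L2_commute[of L "g_kernel L"])
  ultimately have Z: "?Z s = Z0 * exp (L * K * s)" if "0 \<le> s" for s
    using that by simp
  have heat: "heat_trajectory L (\<lambda>t. K * (Z0 * exp (L * K * t))) u"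
    by (rule heat_trajectory_cong[OF cascade_heat_trajectory[OF casc KZ]]) (simp add: Z)
  have vheat: "heat_trajectory L (\<lambda>t. K * (Z0 * exp (L * K * t))) v"
    unfolding v_def using L K nonres u0 by (rule closed_loop_state_heat_trajectory)
  show AE: "AE x in lebesgue_on {0..L}. u t x = v t x"
    by (rule heat_trajectory_unique[OF L heat vheat _ t]) (use init in \<open>simp add: v_def closed_loop_state_0\<close>)
  have "inner_L2 L (u t) (g_kernel L) = inner_L2 L (v t) (g_kernel L)"
    using vheat t by (intro inner_L2_cong_AE AE L2_trajectory_L2_on[OF traj])
      (auto simp: heat_trajectory_def L2_trajectory_L2_on)
  then show "\<theta> t = Z0 * exp (L * K * t) - inner_L2 L (g_kernel L) (v t)"
    using Z[OF t] by (simp add: Z_state_inner inner_L2_commute[of L "g_kernel L"])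
qed

text \<open>
Both parts of the state decay: the particular solution at rate \<open>- L K\<close>, the homogeneous one at rate \<open>\<omega>\<^sub>0\<^sup>2\<close>.
Their amplitudes, \<open>Z(0)\<close> and the norm of the initial deviation from the profile, are bounded by the initial
state, with \<open>c1\<close> the factor for \<open>Z(0)\<^sup>2\<close> and \<open>c3\<close> the factor for \<open>\<parallel>u\<parallel>\<^sup>2\<close>.
\<close>

lemma closed_loop_state_decay:
  fixes \<theta>0 :: real
  assumes L: "L > 0" and K: "K < 0" and u0: "L2_on L u0" and t: "0 \<le> t"
  defines "G \<equiv> inner_L2 L (g_kernel L) (g_kernel L)"
    and "P \<equiv> inner_L2 L (profile L K) (profile L K)"
    and "\<nu> \<equiv> 2 * min (- (L * K)) ((freq L 0)\<^sup>2)"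
    and "Z0 \<equiv> \<theta>0 + inner_L2 L (g_kernel L) u0"
    and "\<Omega>0 \<equiv> \<theta>0\<^sup>2 + inner_L2 L u0 u0"
  defines "v \<equiv> closed_loop_state L K Z0 u0"
    and "c1 \<equiv> 2 * (1 + G)"
  defines "c3 \<equiv> 2 * (K\<^sup>2 * P * c1) + 2 * (2 + 2 * (K\<^sup>2 * P * c1))"
  shows "(Z0 * exp (L * K * t) - inner_L2 L (g_kernel L) (v t))\<^sup>2 + inner_L2 L (v t) (v t)
    \<le> (2 * c1 + 2 * (G * c3) + c3) * \<Omega>0 * exp (- \<nu> * t)"
proof -
  have sq_add: "(a + b)\<^sup>2 \<le> 2 * a\<^sup>2 + 2 * b\<^sup>2" for a b :: real
    using sum_squares_bound[of a b] by (simp add: power2_sum)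
  have nonneg: "0 \<le> G" "0 \<le> P" "0 \<le> inner_L2 L u0 u0"
    by (simp_all add: G_def P_def inner_L2_self_nonneg)
  then have \<Omega>0: "0 \<le> \<Omega>0" "inner_L2 L u0 u0 \<le> \<Omega>0" "\<theta>0\<^sup>2 \<le> \<Omega>0" by (simp_all add: \<Omega>0_def)
  let ?e = "exp (- \<nu> * t)" and ?w = "\<lambda>x. u0 x - K * Z0 * profile L K x"
  have "\<nu> \<le> 2 * (- (L * K))" "\<nu> \<le> 2 * (freq L 0)\<^sup>2"
    unfolding \<nu>_def by linarith+
  then have "\<nu> * t \<le> 2 * (- (L * K)) * t" "\<nu> * t \<le> 2 * (freq L 0)\<^sup>2 * t"
    using t by (simp_all only: mult_right_mono)
  then have rates: "(exp (L * K * t))\<^sup>2 \<le> ?e" "exp (- (2 * (freq L 0)\<^sup>2 * t)) \<le> ?e"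
    by (simp_all flip: exp_double)
  have Z0: "Z0\<^sup>2 \<le> c1 * \<Omega>0"
  proof -
    have "Z0\<^sup>2 \<le> 2 * \<theta>0\<^sup>2 + 2 * (inner_L2 L (g_kernel L) u0)\<^sup>2" unfolding Z0_def by (rule sq_add)
    also have "\<dots> \<le> 2 * \<theta>0\<^sup>2 + 2 * (G * inner_L2 L u0 u0)"
      using inner_L2_Cauchy_Schwarz[OF g_kernel_L2_on u0] by (simp add: G_def)
    also have "\<dots> \<le> 2 * \<Omega>0 + 2 * (G * \<Omega>0)"
      using \<Omega>0 nonneg by (intro add_mono mult_left_mono) auto
    finally show ?thesis by (simp add: c1_def algebra_simps)
  qed
  have KZ: "(K * Z0)\<^sup>2 * P \<le> K\<^sup>2 * P * c1 * \<Omega>0"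
    using mult_left_mono[OF Z0, of "K\<^sup>2 * P"] nonneg by (simp add: power_mult_distrib mult_ac)
  have w: "L2_on L ?w" using u0 by (intro L2_on_diff L2_on_cmult) auto
  have "inner_L2 L (\<lambda>x. u0 x + (- (K * Z0)) * profile L K x) (\<lambda>x. u0 x + (- (K * Z0)) * profile L K x)
      \<le> 2 * inner_L2 L u0 u0 + 2 * inner_L2 L (\<lambda>x. (- (K * Z0)) * profile L K x) (\<lambda>x. (- (K * Z0)) * profile L K x)"
    by (intro inner_L2_self_add_le u0 L2_on_cmult profile_L2_on)
  then have "inner_L2 L ?w ?w \<le> 2 * inner_L2 L u0 u0 + 2 * ((K * Z0)\<^sup>2 * P)"
    by (simp only: inner_L2_cmult_left inner_L2_cmult_right P_def) (simp add: power2_eq_square mult_ac)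
  also have "\<dots> \<le> 2 * \<Omega>0 + 2 * (K\<^sup>2 * P * c1 * \<Omega>0)"
    by (intro add_mono mult_left_mono \<Omega>0 KZ) auto
  also have "\<dots> = (2 + 2 * (K\<^sup>2 * P * c1)) * \<Omega>0" by (simp add: algebra_simps)
  finally have w0: "inner_L2 L ?w ?w \<le> (2 + 2 * (K\<^sup>2 * P * c1)) * \<Omega>0" .
  have flow: "L2_on L (heat_flow L ?w t)" using L w t by (rule heat_flow_L2_on)
  have v_split: "v t = (\<lambda>x. K * Z0 * exp (L * K * t) * profile L K x + heat_flow L ?w t x)"
    by (simp add: v_def closed_loop_state_def fun_eq_iff)
  have v: "L2_on L (v t)" unfolding v_split by (intro L2_on_add L2_on_cmult flow profile_L2_on)
  have "inner_L2 L (v t) (v t)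
      \<le> 2 * inner_L2 L (\<lambda>x. K * Z0 * exp (L * K * t) * profile L K x) (\<lambda>x. K * Z0 * exp (L * K * t) * profile L K x)
        + 2 * inner_L2 L (heat_flow L ?w t) (heat_flow L ?w t)"
    unfolding v_split by (intro inner_L2_self_add_le L2_on_cmult flow profile_L2_on)
  also have "\<dots> = 2 * ((K * Z0)\<^sup>2 * P * (exp (L * K * t))\<^sup>2) + 2 * inner_L2 L (heat_flow L ?w t) (heat_flow L ?w t)"
    unfolding inner_L2_cmult_left inner_L2_cmult_right P_def by (simp add: power2_eq_square mult_ac)
  also have "\<dots> \<le> 2 * (K\<^sup>2 * P * c1 * \<Omega>0 * ?e) + 2 * (?e * ((2 + 2 * (K\<^sup>2 * P * c1)) * \<Omega>0))"
  proof (intro add_mono mult_left_mono)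
    show "(K * Z0)\<^sup>2 * P * (exp (L * K * t))\<^sup>2 \<le> K\<^sup>2 * P * c1 * \<Omega>0 * ?e"
      using nonneg by (intro mult_mono' KZ rates) auto
    have "inner_L2 L (heat_flow L ?w t) (heat_flow L ?w t) \<le> exp (- (2 * (freq L 0)\<^sup>2 * t)) * inner_L2 L ?w ?w"
      using L w t by (rule heat_flow_decay)
    also have "\<dots> \<le> ?e * ((2 + 2 * (K\<^sup>2 * P * c1)) * \<Omega>0)"
      by (intro mult_mono' rates w0 inner_L2_self_nonneg) auto
    finally show "inner_L2 L (heat_flow L ?w t) (heat_flow L ?w t) \<le> ?e * ((2 + 2 * (K\<^sup>2 * P * c1)) * \<Omega>0)" .
  qed auto
  also have "\<dots> = c3 * \<Omega>0 * ?e" by (simp add: c3_def algebra_simps)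
  finally have vt: "inner_L2 L (v t) (v t) \<le> c3 * \<Omega>0 * ?e" .
  have "(Z0 * exp (L * K * t) - inner_L2 L (g_kernel L) (v t))\<^sup>2
      \<le> 2 * (Z0\<^sup>2 * (exp (L * K * t))\<^sup>2) + 2 * (inner_L2 L (g_kernel L) (v t))\<^sup>2"
    using sq_add[of "Z0 * exp (L * K * t)" "- inner_L2 L (g_kernel L) (v t)"]
    by (simp add: power_mult_distrib)
  also have "\<dots> \<le> 2 * (c1 * \<Omega>0 * ?e) + 2 * (G * (c3 * \<Omega>0 * ?e))"
  proof (intro add_mono mult_left_mono)
    show "Z0\<^sup>2 * (exp (L * K * t))\<^sup>2 \<le> c1 * \<Omega>0 * ?e" by (intro mult_mono' Z0 rates) auto
    have "(inner_L2 L (g_kernel L) (v t))\<^sup>2 \<le> G * inner_L2 L (v t) (v t)"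
      unfolding G_def by (rule inner_L2_Cauchy_Schwarz[OF g_kernel_L2_on v])
    also have "\<dots> \<le> G * (c3 * \<Omega>0 * ?e)" by (intro mult_left_mono vt nonneg)
    finally show "(inner_L2 L (g_kernel L) (v t))\<^sup>2 \<le> G * (c3 * \<Omega>0 * ?e)" .
  qed auto
  finally have "(Z0 * exp (L * K * t) - inner_L2 L (g_kernel L) (v t))\<^sup>2 + inner_L2 L (v t) (v t)
      \<le> 2 * (c1 * \<Omega>0 * ?e) + 2 * (G * (c3 * \<Omega>0 * ?e)) + c3 * \<Omega>0 * ?e"
    using vt by (rule add_mono)
  also have "\<dots> = (2 * c1 + 2 * (G * c3) + c3) * \<Omega>0 * ?e" by (simp add: algebra_simps)
  finally show ?thesis .
qed

theorem theorem1:
  fixes L K :: real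
  assumes "L > 0"
    and "K < 0"
    and "\<And>\<kappa>::nat. K \<noteq> - ((2 * real \<kappa> + 1)\<^sup>2 * pi\<^sup>2 / (4 * L ^ 3))"
  shows "(\<forall>\<theta>0 u0. L2_on L u0 \<longrightarrow>
            (\<exists>\<theta> u. closed_loop_solution L K \<theta>0 u0 \<theta> u \<and>
               (\<forall>\<theta>' u'. closed_loop_solution L K \<theta>0 u0 \<theta>' u' \<longrightarrow>
                  (\<forall>t\<ge>0. \<theta>' t = \<theta> t \<and> (AE x in lebesgue_on {0..L}. u' t x = u t x))))) \<and>
         (\<exists>\<eta>>0. \<exists>\<nu>>0. \<forall>\<theta>0 u0 \<theta> u. L2_on L u0 \<longrightarrow> closed_loop_solution L K \<theta>0 u0 \<theta> u \<longrightarrow>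
            (\<forall>t\<ge>0. Omega L \<theta> u t \<le> \<eta> * Omega L \<theta> u 0 * exp (- \<nu> * t)))"
proof (intro conjI allI impI)
  note L = assms(1) and K = assms(2)
  have nonres: "cos (sqrt (- (L * K)) * L) \<noteq> 0" using assms by (rule cos_at_L_nonzero)
  fix \<theta>0 u0 assume u0: "L2_on L u0"
  show "\<exists>\<theta> u. closed_loop_solution L K \<theta>0 u0 \<theta> u \<and>
               (\<forall>\<theta>' u'. closed_loop_solution L K \<theta>0 u0 \<theta>' u' \<longrightarrow>
                  (\<forall>t\<ge>0. \<theta>' t = \<theta> t \<and> (AE x in lebesgue_on {0..L}. u' t x = u t x)))"
    using closed_loop_solution_exists[OF L K nonres u0] closed_loop_solution_formula[OF L K nonres u0]
    by blast
next
  note L = assms(1) and K = assms(2)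
  have nonres: "cos (sqrt (- (L * K)) * L) \<noteq> 0" using assms by (rule cos_at_L_nonzero)
  let ?G = "inner_L2 L (g_kernel L) (g_kernel L)" and ?P = "inner_L2 L (profile L K) (profile L K)"
  let ?\<nu> = "2 * min (- (L * K)) ((freq L 0)\<^sup>2)" and ?c1 = "2 * (1 + ?G)"
  let ?c3 = "2 * (K\<^sup>2 * ?P * ?c1) + 2 * (2 + 2 * (K\<^sup>2 * ?P * ?c1))"
  let ?\<eta> = "2 * ?c1 + 2 * (?G * ?c3) + ?c3"
  have "0 < ?\<nu>" using L K by (simp add: freq_def mult_pos_neg)
  moreover have "0 < ?\<eta>"
  proof -
    have "0 \<le> ?G" "0 \<le> ?P" by (rule inner_L2_self_nonneg)+
    then have "0 \<le> ?c3" "0 < ?c1" "0 \<le> ?G * ?c3" by simp_all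
    then show ?thesis by linarith
  qed
  moreover have "Omega L \<theta> u t \<le> ?\<eta> * Omega L \<theta> u 0 * exp (- ?\<nu> * t)"
    if sol: "closed_loop_solution L K \<theta>0 u0 \<theta> u" and t: "0 \<le> t" for \<theta>0 u0 \<theta> u t
  proof -
    have traj: "L2_trajectory L u"
      using sol by (simp add: closed_loop_solution_def cascade_solution_def continuous_state_iff)
    have u_0: "L2_on L (u 0)" using traj by (simp add: L2_trajectory_L2_on)
    \<comment> \<open>Taking \<open>u 0\<close> itself as initial datum, instead of the function it equals almost everywhere, makes \<open>\<Omega>(0)\<close> appear literally.\<close>
    have sol0: "closed_loop_solution L K (\<theta> 0) (u 0) \<theta> u"
      using sol by (simp add: closed_loop_solution_def)
    let ?Z0 = "\<theta> 0 + inner_L2 L (g_kernel L) (u 0)"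
    let ?v = "closed_loop_state L K ?Z0 (u 0)"
    note formula = closed_loop_solution_formula[OF L K nonres u_0 sol0 t]
    have "(LINT x|lebesgue_on {0..L}. (u t x)\<^sup>2) = (LINT x|lebesgue_on {0..L}. (?v t x)\<^sup>2)"
    proof (rule integral_cong_AE)
      have "heat_trajectory L (\<lambda>t. K * (?Z0 * exp (L * K * t))) ?v"
        using L K nonres u_0 by (rule closed_loop_state_heat_trajectory)
      then have "L2_on L (?v t)" using t by (simp add: heat_trajectory_def L2_trajectory_L2_on)
      then show "(\<lambda>x. (?v t x)\<^sup>2) \<in> borel_measurable (lebesgue_on {0..L})"
        by (intro borel_measurable_power L2_on_measurable)
      show "(\<lambda>x. (u t x)\<^sup>2) \<in> borel_measurable (lebesgue_on {0..L})"
        using traj t by (intro borel_measurable_power L2_on_measurable L2_trajectory_L2_on)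
      show "AE x in lebesgue_on {0..L}. (u t x)\<^sup>2 = (?v t x)\<^sup>2"
        using formula(1) by eventually_elim simp
    qed
    then have "Omega L \<theta> u t
        = (?Z0 * exp (L * K * t) - inner_L2 L (g_kernel L) (?v t))\<^sup>2 + inner_L2 L (?v t) (?v t)"
      by (simp only: Omega_def power2_abs formula(2) inner_L2_self)
    also have "\<dots> \<le> ?\<eta> * ((\<theta> 0)\<^sup>2 + inner_L2 L (u 0) (u 0)) * exp (- ?\<nu> * t)"
      by (rule closed_loop_state_decay[OF L K u_0 t])
    also have "(\<theta> 0)\<^sup>2 + inner_L2 L (u 0) (u 0) = Omega L \<theta> u 0"
      by (simp add: Omega_def inner_L2_self)
    finally show ?thesis .
  qed
  ultimately show "\<exists>\<eta>>0. \<exists>\<nu>>0. \<forall>\<theta>0 u0 \<theta> u. L2_on L u0 \<longrightarrow> closed_loop_solution L K \<theta>0 u0 \<theta> u \<longrightarrow>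
            (\<forall>t\<ge>0. Omega L \<theta> u t \<le> \<eta> * Omega L \<theta> u 0 * exp (- \<nu> * t))"
    by blast
qed

end
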